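(* (i) Let $S\equiv\pm\{1, 7, 8, 10, 11, 13, 14, 17, 19, 20, 23, 29\}\pmod{60}$ and $T\equiv\pm\{1, 6, 7, 9, 10, 13, 17, 20, 21, 23, 28, 29\}\pmod{60}$. Then $p(S,n)=p(T,n-1)$ for all $n\geq 1$. (ii) Let $S\equiv\pm\{1, 4, 7, 10, 11, 13, 17, 19, 20, 22, 23, 29\}\pmod{60}$ and $T\equiv\pm\{1, 3, 7, 10, 11, 16, 18, 19, 20, 23, 27, 29\}\pmod{60}$. Then $p(S,n)=p(T,n-1)$ for all $n\geq 1$. (iii) Let $S\equiv\pm\{6, 7, 8, 9, 10, 11, 13, 17, 19, 20, 21, 23\}\pmod{60}$ and $T\equiv\pm\{1, 7, 10, 11, 13, 17, 19, 20, 23, 26, 28, 29\}\pmod{60}$. Then $p(S,n)=p(T,n-6)$ for all $n\geq 6$. (iv) Let $S\equiv\pm\{1, 3, 4, 10, 11, 13, 17, 18, 19, 20, 27, 29\}\pmod{60}$ and $T\equiv\pm\{1, 2, 7, 10, 11, 13, 16, 17, 19, 20, 23, 29\}\pmod{60}$. Then $p(S,n)=p(T,n)$ for all integers $n\ge0$ with $n\neq 2$.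
   Context: For a set $S$ of positive integers and an integer $n\ge 0$, $p(S,n)$ denotes the number of partitions of $n$ into parts belonging to $S$ (so $p(S,0)=1$). The notation $S\equiv\pm\{r_1,\dots,r_k\}\pmod M$ means that $S$ is the set of all positive integers $n$ such that $n\equiv r_i$ or $n\equiv -r_i\pmod M$ for some $i$. *)

theory Defs
  imports "HOL-Library.Multiset" "HOL-Number_Theory.Cong"
begin

definition pm_residues :: "int set \<Rightarrow> int \<Rightarrow> nat set" where
  "pm_residues R M = {n. n > 0 \<and> (\<exists>r\<in>R. [int n = r] (mod M) \<or> [int n = - r] (mod M))}"

text \<open>A partition is the multiset of its parts. The count is only meaningful for a set
  \<open>S\<close> of positive integers, where the set of partitions of \<open>n\<close> is finite.\<close>

definition num_partitions :: "nat set \<Rightarrow> nat \<Rightarrow> nat" where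
  "num_partitions S n = card {P :: nat multiset. set_mset P \<subseteq> S \<and> sum_mset P = n}"

lemma finite_partitions:
  assumes "0 \<notin> S"
  shows "finite {P :: nat multiset. set_mset P \<subseteq> S \<and> sum_mset P = n}"
proof (rule finite_subset)
  have *: "size P \<le> sum_mset P" if "0 \<notin># P" for P :: "nat multiset"
    using that by (induction P) auto
  show "{P. set_mset P \<subseteq> S \<and> sum_mset P = n} \<subseteq> mset ` {xs. set xs \<subseteq> {..n} \<and> length xs \<le> n}"
  proof
    fix P assume "P \<in> {P. set_mset P \<subseteq> S \<and> sum_mset P = n}"
    then have P: "set_mset P \<subseteq> S" "sum_mset P = n" by auto
    obtain xs where xs: "mset xs = P" using ex_mset by blast
    have "size P \<le> n" using * P assms by blast
    moreover have "set_mset P \<subseteq> {..n}"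
      using P(2) by (auto dest!: multi_member_split)
    ultimately show "P \<in> mset ` {xs. set xs \<subseteq> {..n} \<and> length xs \<le> n}"
      using xs by auto
  qed
  show "finite (mset ` {xs. set xs \<subseteq> {..n} \<and> length xs \<le> n})"
    by (intro finite_imageI finite_lists_length_le) auto
qed

lemma zero_notin_pm_residues: "0 \<notin> pm_residues R M"
  by (simp add: pm_residues_def)

end

theory Submission
  imports Defs "HOL-Complex_Analysis.Cauchy_Integral_Formula"
begin

text \<open>
  For \<open>0 < q < 1\<close> let \<open>[a]\<close> be the product of the factors \<open>1 - q\<^sup>n\<close> over all \<open>n > 0\<close> congruent to
  \<open>\<plusminus>a\<close> modulo 60. In terms of generating functions, the four claims are the images under
  \<open>a \<mapsto> k a\<close> (\<open>k = 1, 7, 11, 17\<close>) of the single identity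
  \<open>1 / ([8][14]) - q [11][19] / ([6][9][21][28]) = E\<close>, where \<open>E\<close> is the product of the \<open>[a]\<close> over all \<open>a < 30\<close>
  that are coprime to 30 or equal to 10 or 20.

  Up to a power of \<open>q\<close> and a factor independent of \<open>a\<close>, \<open>[a]\<close> is a theta series \<open>F(a)\<close> for which
  \<open>F(x + y) F(x - y)\<close> is a 2 by 2 determinant with columns depending on \<open>x\<close> and on \<open>y\<close>; the Pluecker
  relation between such determinants gives a three-term relation. Three instances of it turn each of the four
  identities into one and the same relation between products of modulus 12. The latter comes from the
  double series \<open>\<Sum> (-1)\<^sup>m \<omega>\<^bsup>n - m\<^esup> q\<^bsup>n n + 5 m m\<^esup>\<close> with \<open>\<omega>\<close> a primitive cube root of unity: it
  factors into two infinite products by the triple product identity, and splitting it by the residue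
  of \<open>n - m\<close> modulo 6 yields the three theta products on the other side.
\<close>

no_notation Infinite_Sum.abs_summable_on (infixr "abs'_summable'_on" 46)
notation Infinite_Set_Sum.abs_summable_on (infix "abs'_summable'_on" 50)

section \<open>The Jacobi triple product\<close>

text \<open>The general term of the bilateral series in the triple product. The sign is absorbed
  into the base \<open>- z\<close>, and the division by 2 is exact because
  \<open>j * (j - 1)\<close> is even.\<close>

definition triple_coeff :: "'a \<Rightarrow> 'a \<Rightarrow> int \<Rightarrow> 'a::field" where
  "triple_coeff Q z j = (- z) powi j * Q powi (j * (j - 1) div 2)"

text \<open>The triangular exponent grows by exactly \<open>j\<close>. This ratio of neighbouring
  terms drives both the finite product expansion and the ratio test for convergence.\<close>

lemma triple_coeff_Suc:
  assumes "Q \<noteq> 0" "z \<noteq> 0"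
  shows "triple_coeff Q z (j + 1) = - z * Q powi j * triple_coeff Q z j"
proof -
  have "(j + 1) * (j + 1 - 1) = j * (j - 1) + j * 2"
    by (simp add: algebra_simps)
  hence "(j + 1) * (j + 1 - 1) div 2 = j * (j - 1) div 2 + j"
    by simp
  thus ?thesis
    using assms by (simp add: triple_coeff_def power_int_add mult_ac)
qed

section \<open>Gaussian binomial coefficients and the finite triple product\<close>

definition qfact :: "'a::field \<Rightarrow> nat \<Rightarrow> 'a" where
  "qfact Q n = (\<Prod>k<n. 1 - Q ^ Suc k)"

text \<open>The reciprocal of the \<open>q\<close>-factorial, extended by zero to negative arguments; this convention makes
  the recurrence below valid at the boundary of the summation range.\<close>

definition rfact :: "'a::field \<Rightarrow> int \<Rightarrow> 'a" where
  "rfact Q n = (if n < 0 then 0 else inverse (qfact Q (nat n)))"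

lemma qfact_Suc: "qfact Q (Suc n) = qfact Q n * (1 - Q ^ Suc n)"
  by (simp add: qfact_def)

lemma qfact_nonzero:
  fixes Q :: "'a::real_normed_field"
  assumes "norm Q < 1"
  shows "qfact Q n \<noteq> 0"
proof -
  have "Q ^ Suc k \<noteq> 1" for k
  proof
    assume "Q ^ Suc k = 1"
    hence "norm Q ^ Suc k = 1"
      by (metis norm_one norm_power)
    moreover have "norm Q ^ Suc k \<le> norm Q ^ 1"
      using assms by (intro power_decreasing) auto
    ultimately show False using assms by simp
  qed
  hence "1 - Q ^ Suc k \<noteq> 0" for k
    by (metis right_minus_eq)
  thus ?thesis by (simp add: qfact_def)
qed

text \<open>At \<open>n = 0\<close> both sides vanish, the left one by the convention for negative
  arguments and the right one through the factor \<open>1 - 1\<close>.\<close>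

lemma rfact_pred:
  fixes Q :: "'a::real_normed_field"
  assumes "norm Q < 1" "n \<ge> 0"
  shows "rfact Q (n - 1) = rfact Q n * (1 - Q ^ nat n)"
proof (cases "n = 0")
  case False
  then obtain k where k: "n = int (Suc k)"
    using assms(2) by (metis nonneg_int_cases not0_implies_Suc of_nat_0)
  have "1 - Q * Q ^ k \<noteq> 0"
    using qfact_nonzero[OF assms(1), of "Suc k"] by (simp add: qfact_Suc)
  thus ?thesis
    using k by (simp add: rfact_def qfact_Suc nat_add_distrib)
qed (simp add: rfact_def)

text \<open>The Gaussian binomial coefficient of \<open>2 * m\<close> over \<open>m + j\<close>,
  centred so that it is symmetric in \<open>j\<close>. Through \<open>rfact\<close> it vanishes
  outside the range from \<open>- m\<close> to \<open>m\<close>.\<close>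

definition qcoeff :: "'a::field \<Rightarrow> nat \<Rightarrow> int \<Rightarrow> 'a" where
  "qcoeff Q m j = qfact Q (2 * m) * rfact Q (int m - j) * rfact Q (int m + j)"

lemma qcoeff_eq_0: "\<bar>j\<bar> > int m \<Longrightarrow> qcoeff Q m j = 0"
  by (auto simp: qcoeff_def rfact_def)

text \<open>The three terms mirror the expansion of the next factor of the finite product. Expressed
  through \<open>rfact Q u\<close> and \<open>rfact Q v\<close>, the claim becomes a polynomial
  identity in powers of \<open>Q\<close>.\<close>

lemma qcoeff_Suc:
  fixes Q :: "'a::real_normed_field"
  assumes Q: "norm Q < 1" and j: "\<bar>j\<bar> \<le> int m + 1"
  shows "qcoeff Q (Suc m) j = (1 + Q ^ (2 * m + 1)) * qcoeff Q m j
           + Q ^ nat (int m + 1 - j) * qcoeff Q m (j - 1)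
           + Q ^ nat (int m + 1 + j) * qcoeff Q m (j + 1)"
proof -
  define u v where "u = int m + 1 - j" and "v = int m + 1 + j"
  have uv: "u \<ge> 0" "v \<ge> 0" using j by (auto simp: u_def v_def)
  define X Y where "X = Q ^ nat u" and "Y = Q ^ nat v"
  define X' Y' where "X' = Q ^ nat (u - 1)" and "Y' = Q ^ nat (v - 1)"
  define R S where "R = rfact Q u" and "S = rfact Q v"
  have r1: "rfact Q (u - 1) = R * (1 - X)" "rfact Q (v - 1) = S * (1 - Y)"
    using rfact_pred[OF Q] uv by (simp_all add: R_def S_def X_def Y_def)
  have r2: "rfact Q (u - 2) = R * (1 - X) * (1 - X')"
  proof (cases "u = 0")
    case False
    hence "rfact Q (u - 1 - 1) = rfact Q (u - 1) * (1 - X')"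
      unfolding X'_def using uv by (intro rfact_pred[OF Q]) auto
    thus ?thesis by (simp add: r1)
  qed (simp add: rfact_def X_def)
  have r3: "rfact Q (v - 2) = S * (1 - Y) * (1 - Y')"
  proof (cases "v = 0")
    case False
    hence "rfact Q (v - 1 - 1) = rfact Q (v - 1) * (1 - Y')"
      unfolding Y'_def using uv by (intro rfact_pred[OF Q]) auto
    thus ?thesis by (simp add: r1)
  qed (simp add: rfact_def Y_def)
  have XY: "X * Y = Q ^ (2 * m + 2)"
    unfolding X_def Y_def power_add[symmetric] using uv
    by (intro arg_cong[where f = "(^) Q"]) (simp add: u_def v_def nat_add_distrib[symmetric])
  have XuY: "X = Q * X'" "X' * Y = Q ^ (2 * m + 1)" if "u \<noteq> 0"
  proof -
    have "nat u = Suc (nat (u - 1))" using uv that by auto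
    thus "X = Q * X'" by (simp add: X_def X'_def)
    have "nat (u - 1) + nat v = 2 * m + 1"
      using uv that by (simp add: u_def v_def nat_add_distrib[symmetric])
    thus "X' * Y = Q ^ (2 * m + 1)"
      unfolding X'_def Y_def power_add[symmetric] by simp
  qed
  have XvY: "Y = Q * Y'" "X * Y' = Q ^ (2 * m + 1)" if "v \<noteq> 0"
  proof -
    have "nat v = Suc (nat (v - 1))" using uv that by auto
    thus "Y = Q * Y'" by (simp add: Y_def Y'_def)
    have "nat u + nat (v - 1) = 2 * m + 1"
      using uv that by (simp add: u_def v_def nat_add_distrib[symmetric])
    thus "X * Y' = Q ^ (2 * m + 1)"
      unfolding X_def Y'_def power_add[symmetric] by simp
  qed
  \<comment> \<open>If \<open>u\<close> or \<open>v\<close> is zero, the truncated exponent in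
    \<open>X'\<close> or \<open>Y'\<close> destroys the relation to \<open>X\<close> or
    \<open>Y\<close>; the accompanying factor \<open>1 - X\<close> or \<open>1 - Y\<close> is then
    zero, so these cases are separate.\<close>
  have main: "(1 - Q ^ (2 * m + 1)) * (1 - X * Y) = (1 + Q ^ (2 * m + 1)) * (1 - X) * (1 - Y)
      + X * (1 - Y) * (1 - Y') + Y * (1 - X) * (1 - X')"
  proof (cases "v = 0")
    case True
    hence "Y = 1" "u \<noteq> 0" by (auto simp: Y_def u_def v_def)
    with XuY XY show ?thesis by simp
  next
    case v: False
    show ?thesis
    proof (cases "u = 0")
      case True
      hence "X = 1" by (simp add: X_def)
      with XvY[OF v] XY show ?thesis by simp
    next
      case False
      show ?thesis
        unfolding XvY(2)[OF v, symmetric] using XvY(1)[OF v] XuY(1)[OF False] by algebra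
    qed
  qed
  have q2: "qfact Q (2 * Suc m) = qfact Q (2 * m) * ((1 - Q ^ (2 * m + 1)) * (1 - X * Y))"
    by (simp add: XY qfact_Suc)
  have e: "int m - j = u - 1" "int m + j = v - 1" "int m - (j - 1) = u" "int m + (j - 1) = v - 2"
    "int m - (j + 1) = u - 2" "int m + (j + 1) = v" "int (Suc m) - j = u" "int (Suc m) + j = v"
    by (simp_all add: u_def v_def)
  have "qcoeff Q (Suc m) j = qfact Q (2 * m) * R * S * ((1 - Q ^ (2 * m + 1)) * (1 - X * Y))"
    unfolding qcoeff_def q2 e R_def S_def by (simp only: mult_ac)
  also have "\<dots> = (1 + Q ^ (2 * m + 1)) * qcoeff Q m j + X * qcoeff Q m (j - 1) + Y * qcoeff Q m (j + 1)"
    unfolding main qcoeff_def e r1 r2 r3 R_def[symmetric] S_def[symmetric] by algebra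
  finally show ?thesis by (simp only: X_def Y_def u_def v_def)
qed

text \<open>Induction on \<open>m\<close>: the new factor expands to
  \<open>1 + Q ^ (2 * m + 1)\<close> minus \<open>z * Q ^ m\<close> minus
  \<open>Q ^ Suc m / z\<close>. The last two terms shift the summation index by one, and
  \<open>qcoeff_Suc\<close> recombines the pieces.\<close>

lemma finite_triple_product:
  fixes Q z :: "'a::real_normed_field"
  assumes Q: "norm Q < 1" "Q \<noteq> 0" and z: "z \<noteq> 0"
  shows "(\<Prod>k<m. (1 - z * Q ^ k) * (1 - Q ^ Suc k / z))
           = (\<Sum>j\<in>{-int m..int m}. triple_coeff Q z j * qcoeff Q m j)"
proof (induction m)
  case 0
  show ?case by (simp add: triple_coeff_def qcoeff_def rfact_def qfact_def)
next
  case (Suc m)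
  define A where "A = triple_coeff Q z"
  define C where "C = qcoeff Q m"
  define I where "I = {-int m - 1..int m + 1}"
  have A1: "A (j + 1) = - z * Q powi j * A j" for j
    unfolding A_def by (rule triple_coeff_Suc[OF Q(2) z])
  \<comment> \<open>Multiplication by \<open>- z * Q ^ m\<close> raises the index by one;
    \<open>dn\<close> below treats the term that lowers it. Widening the range to \<open>I\<close>
    only adds zeros.\<close>
  have up: "(\<Sum>j\<in>I. A j * C j * (- z * Q ^ m)) = (\<Sum>j\<in>I. A j * (Q ^ nat (int m + 1 - j) * C (j - 1)))"
  proof -
    have "(\<Sum>j\<in>I. A j * C j * (- z * Q ^ m)) = (\<Sum>j\<in>{-int m..int m}. A j * C j * (- z * Q ^ m))"
      unfolding I_def C_def by (rule sum.mono_neutral_right) (auto simp: qcoeff_eq_0)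
    also have "\<dots> = (\<Sum>j\<in>{-int m+1..int m+1}. A j * (Q ^ nat (int m + 1 - j) * C (j - 1)))"
    proof (rule sum.reindex_bij_witness[where i = "\<lambda>j. j - 1" and j = "\<lambda>j. j + 1"])
      fix j assume j: "j \<in> {-int m..int m}"
      have "Q ^ nat (int m - j) * Q powi j = Q powi (int m - j) * Q powi j"
        using j by (simp add: power_int_def)
      also have "\<dots> = Q ^ m" using Q by (simp add: power_int_add[symmetric])
      finally have "Q ^ nat (int m - j) * Q powi j = Q ^ m" .
      thus "A (j + 1) * (Q ^ nat (int m + 1 - (j + 1)) * C (j + 1 - 1)) = A j * C j * (- z * Q ^ m)"
        by (simp add: A1) (metis (no_types, lifting) mult.commute mult.left_commute)
    qed auto
    also have "\<dots> = (\<Sum>j\<in>I. A j * (Q ^ nat (int m + 1 - j) * C (j - 1)))"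
      unfolding I_def C_def by (rule sum.mono_neutral_left) (auto simp: qcoeff_eq_0)
    finally show ?thesis .
  qed
  have dn: "(\<Sum>j\<in>I. A j * C j * (- (Q ^ Suc m / z))) = (\<Sum>j\<in>I. A j * (Q ^ nat (int m + 1 + j) * C (j + 1)))"
  proof -
    have "(\<Sum>j\<in>I. A j * C j * (- (Q ^ Suc m / z))) = (\<Sum>j\<in>{-int m..int m}. A j * C j * (- (Q ^ Suc m / z)))"
      unfolding I_def C_def by (rule sum.mono_neutral_right) (auto simp: qcoeff_eq_0)
    also have "\<dots> = (\<Sum>j\<in>{-int m-1..int m-1}. A j * (Q ^ nat (int m + 1 + j) * C (j + 1)))"
    proof (rule sum.reindex_bij_witness[where i = "\<lambda>j. j + 1" and j = "\<lambda>j. j - 1"])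
      fix j assume j: "j \<in> {-int m..int m}"
      have a: "A j = - z * Q powi (j - 1) * A (j - 1)"
        using A1[of "j - 1"] by simp
      have "Q ^ Suc m * Q powi (j - 1) = Q powi (int (Suc m)) * Q powi (j - 1)"
        by (simp only: power_int_of_nat)
      also have "\<dots> = Q powi (int m + j)"
        using Q by (simp add: power_int_add[symmetric])
      also have "\<dots> = Q ^ nat (int m + j)"
        using j by (simp add: power_int_def)
      finally have "Q ^ Suc m * Q powi (j - 1) = Q ^ nat (int m + j)" .
      hence "A j * C j * (- (Q ^ Suc m / z)) = A (j - 1) * (Q ^ nat (int m + j) * C j)"
        unfolding a using z by (simp add: field_simps)
      thus "A (j - 1) * (Q ^ nat (int m + 1 + (j - 1)) * C (j - 1 + 1)) = A j * C j * (- (Q ^ Suc m / z))"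
        by simp
    qed auto
    also have "\<dots> = (\<Sum>j\<in>I. A j * (Q ^ nat (int m + 1 + j) * C (j + 1)))"
      unfolding I_def C_def by (rule sum.mono_neutral_left) (auto simp: qcoeff_eq_0)
    finally show ?thesis .
  qed
  have fac: "(1 - z * Q ^ m) * (1 - (Q ^ Suc m / z)) = 1 + Q ^ (2 * m + 1) + (- z * Q ^ m) + (- (Q ^ Suc m / z))"
    using z by (simp add: field_simps power_mult power2_eq_square)
  have split3: "(\<Sum>j\<in>I. A j * C j) * (t + p + r)
      = (\<Sum>j\<in>I. A j * (t * C j)) + (\<Sum>j\<in>I. A j * C j * p) + (\<Sum>j\<in>I. A j * C j * r)" for t p r
    by (simp only: distrib_left sum_distrib_right, simp only: mult_ac)
  have "(\<Prod>k<Suc m. (1 - z * Q ^ k) * (1 - Q ^ Suc k / z))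
      = (\<Sum>j\<in>{-int m..int m}. A j * C j) * (1 + Q ^ (2 * m + 1) + (- z * Q ^ m) + (- (Q ^ Suc m / z)))"
    unfolding prod.lessThan_Suc Suc.IH fac A_def C_def ..
  also have "(\<Sum>j\<in>{-int m..int m}. A j * C j) = (\<Sum>j\<in>I. A j * C j)"
    unfolding I_def C_def by (rule sum.mono_neutral_left) (auto simp: qcoeff_eq_0)
  also have "(\<Sum>j\<in>I. A j * C j) * (1 + Q ^ (2 * m + 1) + (- z * Q ^ m) + (- (Q ^ Suc m / z)))
     = (\<Sum>j\<in>I. A j * ((1 + Q ^ (2 * m + 1)) * C j)) + (\<Sum>j\<in>I. A j * C j * (- z * Q ^ m))
        + (\<Sum>j\<in>I. A j * C j * (- (Q ^ Suc m / z)))"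
    by (rule split3)
  also have "\<dots> = (\<Sum>j\<in>I. A j * ((1 + Q ^ (2 * m + 1)) * C j + Q ^ nat (int m + 1 - j) * C (j - 1)
        + Q ^ nat (int m + 1 + j) * C (j + 1)))"
    unfolding up dn by (simp only: sum.distrib[symmetric] distrib_left)
  also have "\<dots> = (\<Sum>j\<in>I. A j * qcoeff Q (Suc m) j)"
    unfolding C_def by (intro sum.cong refl arg_cong2[where f = "(*)"] qcoeff_Suc[OF Q(1), symmetric])
      (auto simp: I_def)
  also have "I = {-int (Suc m)..int (Suc m)}" by (auto simp: I_def)
  finally show ?case unfolding A_def .
qed

section \<open>Convergence and passage to the limit\<close>

lemma triple_coeff_abs_summable:
  fixes Q z :: "'a::{real_normed_field,banach,second_countable_topology}"
  assumes Q: "norm Q < 1" "Q \<noteq> 0" and z: "z \<noteq> 0"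
  shows "triple_coeff Q z abs_summable_on UNIV"
proof -
  \<comment> \<open>For any constant \<open>c\<close> the ratio of consecutive terms tends to 0, so
    the ratio test applies. It is used once in each direction.\<close>
  have geo: "summable (\<lambda>n. norm (g n))"
    if g: "\<And>n. norm (g (Suc n)) \<le> norm c * norm Q ^ n * norm (g n)" for g :: "nat \<Rightarrow> 'a" and c :: 'a
  proof -
    have "(\<lambda>n. norm c * norm Q ^ n) \<longlonglongrightarrow> norm c * 0"
      using Q by (intro tendsto_intros LIMSEQ_power_zero) auto
    hence "\<forall>\<^sub>F n in sequentially. norm c * norm Q ^ n < 1/2"
      by (intro order_tendstoD) auto
    then obtain N where N: "\<And>n. n \<ge> N \<Longrightarrow> norm c * norm Q ^ n < 1/2"
      by (auto simp: eventually_at_top_linorder)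
    show ?thesis
    proof (rule summable_ratio_test[of "1/2" N])
      fix n assume n: "n \<ge> N"
      have "norm (g (Suc n)) \<le> 1/2 * norm (g n)"
        by (rule order.trans[OF g], rule mult_right_mono) (use N[OF n] in auto)
      thus "norm (norm (g (Suc n))) \<le> 1/2 * norm (norm (g n))" by simp
    qed auto
  qed
  note step = triple_coeff_Suc[OF Q(2) z]
  have pos: "summable (\<lambda>n. norm (triple_coeff Q z (int n)))"
  proof (rule geo[where c = z])
    fix n show "norm (triple_coeff Q z (int (Suc n))) \<le> norm z * norm Q ^ n * norm (triple_coeff Q z (int n))"
      using step[of "int n"] by (simp add: add.commute norm_mult norm_power)
  qed
  have neg: "summable (\<lambda>n. norm (triple_coeff Q z (- int n - 1)))"
  \<comment> \<open>Descending from index \<open>- n - 1\<close> to \<open>- n - 2\<close>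
    multiplies the term by \<open>- (Q ^ (n + 2) / z)\<close>, which explains the constant.\<close>
  proof (rule geo[where c = "Q ^ 2 / z"])
    fix n :: nat
    have "triple_coeff Q z (- int n - 1) = - z * Q powi (- int n - 2) * triple_coeff Q z (- int (Suc n) - 1)"
    proof -
      have "- int n - 2 + 1 = - int n - 1" "- int (Suc n) - 1 = - int n - 2" by simp_all
      thus ?thesis using step[of "- int n - 2"] by (simp only:)
    qed
    moreover have "Q powi (- int n - 2) * Q ^ (n + 2) = 1"
    proof -
      have "Q powi (- int n - 2) * Q powi (int (n + 2)) = Q powi 0"
        using Q(2) by (subst power_int_add[symmetric]) auto
      thus ?thesis by (simp only: power_int_of_nat power_int_0_right)
    qed
    ultimately have "triple_coeff Q z (- int (Suc n) - 1) = - (Q ^ (n + 2) / z) * triple_coeff Q z (- int n - 1)"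
      using z by (simp add: field_simps)
    thus "norm (triple_coeff Q z (- int (Suc n) - 1))
        \<le> norm (Q ^ 2 / z) * norm Q ^ n * norm (triple_coeff Q z (- int n - 1))"
      by (simp add: norm_mult norm_power norm_divide power_add power2_eq_square field_simps)
  qed
  have bij1: "bij_betw int UNIV {0..}"
    by (auto simp: bij_betw_def inj_on_def image_iff) (metis nonneg_int_cases)
  have bij2: "bij_betw (\<lambda>n. - int n - 1) UNIV {..<0}"
  proof (rule bij_betwI[where g = "\<lambda>j. nat (- j - 1)"]) qed auto
  have "triple_coeff Q z abs_summable_on {0..}"
    using pos by (subst abs_summable_on_reindex_bij_betw[OF bij1, symmetric])
      (simp add: abs_summable_on_nat_iff')
  moreover have "triple_coeff Q z abs_summable_on {..<0}"
    using neg by (subst abs_summable_on_reindex_bij_betw[OF bij2, symmetric])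
      (simp add: abs_summable_on_nat_iff')
  ultimately have "triple_coeff Q z abs_summable_on ({0..} \<union> {..<0})"
    by (rule abs_summable_on_union)
  moreover have "{0..} \<union> {..<0::int} = UNIV" by auto
  ultimately show ?thesis by simp
qed

lemma qfact_limit:
  fixes Q :: "'a::{real_normed_field,banach}"
  assumes "norm Q < 1"
  obtains L where "L \<noteq> 0" "qfact Q \<longlonglongrightarrow> L"
proof -
  have "summable (\<lambda>k. norm Q ^ Suc k)"
    using assms by (subst summable_Suc_iff) (simp add: summable_geometric)
  hence "abs_convergent_prod (\<lambda>k. 1 - Q ^ Suc k)"
    by (intro summable_imp_abs_convergent_prod) (simp add: norm_power norm_mult)
  hence c: "convergent_prod (\<lambda>k. 1 - Q ^ Suc k)"
    by (rule abs_convergent_prod_imp_convergent_prod)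
  have "(\<lambda>n. \<Prod>k\<le>n. 1 - Q ^ Suc k) \<longlonglongrightarrow> prodinf (\<lambda>k. 1 - Q ^ Suc k)"
    using convergent_prod_LIMSEQ[OF c] .
  hence "qfact Q \<longlonglongrightarrow> prodinf (\<lambda>k. 1 - Q ^ Suc k)"
    unfolding qfact_def LIMSEQ_lessThan_iff_atMost .
  moreover have "prodinf (\<lambda>k. 1 - Q ^ Suc k) \<noteq> 0"
  proof (rule prodinf_nonzero[OF c])
    fix k show "1 - Q ^ Suc k \<noteq> 0"
      using qfact_nonzero[OF assms, of "Suc k"] unfolding qfact_Suc by simp
  qed
  ultimately show ?thesis using that by blast
qed

text \<open>For negative \<open>c\<close> the first few values are zero by convention. After a shift
  by the absolute value of \<open>c\<close> every value is a true reciprocal.\<close>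

lemma tendsto_rfact:
  fixes Q :: "'a::{real_normed_field,banach}"
  assumes "qfact Q \<longlonglongrightarrow> L" "L \<noteq> 0"
  shows "(\<lambda>m. rfact Q (int m + c)) \<longlonglongrightarrow> inverse L"
proof -
  define k where "k = nat \<bar>c\<bar>"
  have "(\<lambda>m. inverse (qfact Q (m + nat (int k + c)))) \<longlonglongrightarrow> inverse L"
    using assms by (intro tendsto_inverse LIMSEQ_ignore_initial_segment)
  moreover have "inverse (qfact Q (m + nat (int k + c))) = rfact Q (int (m + k) + c)" for m
  proof -
    have "nat (int (m + k) + c) = m + nat (int k + c)"
      unfolding k_def by (simp add: nat_add_distrib)
    thus ?thesis by (simp add: rfact_def k_def)
  qed
  ultimately have "(\<lambda>m. rfact Q (int (m + k) + c)) \<longlonglongrightarrow> inverse L" by simp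
  thus ?thesis by (rule LIMSEQ_offset)
qed

text \<open>The finite version is multiplied by \<open>qfact Q m\<close>, which supplies the factors
  \<open>1 - Q ^ Suc k\<close> and makes every coefficient tend to 1. Boundedness of
  \<open>qfact\<close> and of its reciprocal then permits the limit under the sum.\<close>

theorem jacobi_triple_product:
  fixes Q z :: "'a::{real_normed_field,banach,second_countable_topology}"
  assumes Q: "norm Q < 1" "Q \<noteq> 0" and z: "z \<noteq> 0"
  shows "(\<lambda>m. \<Prod>k<m. (1 - Q ^ Suc k) * ((1 - z * Q ^ k) * (1 - Q ^ Suc k / z)))
           \<longlonglongrightarrow> infsetsum (triple_coeff Q z) UNIV"
proof -
  obtain L where L: "L \<noteq> 0" "qfact Q \<longlonglongrightarrow> L"
    using qfact_limit[OF Q(1)] .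
  define s where "s = (\<lambda>m j. triple_coeff Q z j * (qfact Q m * qcoeff Q m j))"
  have inv: "(\<lambda>n. inverse (qfact Q n)) \<longlonglongrightarrow> inverse L"
    using L by (intro tendsto_inverse)
  obtain B1 where B1: "\<And>n. norm (qfact Q n) \<le> B1"
    using convergent_imp_Bseq[of "qfact Q"] L(2) by (auto simp: convergent_def Bseq_def)
  obtain B2 where B2: "\<And>n. norm (inverse (qfact Q n)) \<le> B2"
    using convergent_imp_Bseq[of "\<lambda>n. inverse (qfact Q n)"] inv
    unfolding convergent_def Bseq_def by blast
  have B12: "B1 \<ge> 0" "B2 \<ge> 0"
    using order.trans[OF norm_ge_zero B1[of 0]] order.trans[OF norm_ge_zero B2[of 0]] by auto
  have B3: "norm (rfact Q j) \<le> B2" for j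
    using B2[of "nat j"] B12 by (auto simp: rfact_def)
  have "(\<lambda>m. integral\<^sup>L (count_space UNIV) (s m)) \<longlonglongrightarrow> integral\<^sup>L (count_space UNIV) (triple_coeff Q z)"
  \<comment> \<open>The sum is an integral over counting measure. In the majorant, \<open>B1\<close>
    bounds each of the two q-factorials and \<open>B2\<close> each of the two reciprocals.\<close>
  proof (rule integral_dominated_convergence[where w = "\<lambda>j. norm (triple_coeff Q z j) * (B1 * (B1 * B2 * B2))"])
    show "integrable (count_space UNIV) (\<lambda>j. norm (triple_coeff Q z j) * (B1 * (B1 * B2 * B2)))"
      using abs_summable_on_normI[OF triple_coeff_abs_summable[OF Q z]]
      by (intro integrable_mult_left) (simp add: Infinite_Set_Sum.abs_summable_on_def)
    show "AE j in count_space UNIV. (\<lambda>m. s m j) \<longlonglongrightarrow> triple_coeff Q z j"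
    proof (rule AE_I2)
      fix j
      have "(\<lambda>m. qfact Q m * (qfact Q (2 * m) * rfact Q (int m + (- j)) * rfact Q (int m + j)))
          \<longlonglongrightarrow> L * (L * inverse L * inverse L)"
      proof (intro tendsto_mult tendsto_rfact L)
        have "filterlim (\<lambda>m::nat. 2 * m) at_top sequentially"
          by (rule filterlim_subseq) (auto simp: strict_mono_def)
        thus "(\<lambda>m. qfact Q (2 * m)) \<longlonglongrightarrow> L"
          using filterlim_compose[OF L(2)] by blast
      qed
      hence "(\<lambda>m. qfact Q m * qcoeff Q m j) \<longlonglongrightarrow> 1"
        using L(1) by (simp add: qcoeff_def)
      hence "(\<lambda>m. triple_coeff Q z j * (qfact Q m * qcoeff Q m j)) \<longlonglongrightarrow> triple_coeff Q z j * 1"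
        by (intro tendsto_mult tendsto_const)
      thus "(\<lambda>m. s m j) \<longlonglongrightarrow> triple_coeff Q z j"
        by (simp add: s_def)
    qed
    show "AE j in count_space UNIV. norm (s m j) \<le> norm (triple_coeff Q z j) * (B1 * (B1 * B2 * B2))" for m
    proof (rule AE_I2)
      fix j
      show "norm (s m j) \<le> norm (triple_coeff Q z j) * (B1 * (B1 * B2 * B2))"
        unfolding s_def norm_mult qcoeff_def
        by (intro mult_mono mult_nonneg_nonneg order.refl norm_ge_zero B1 B3 B12)
    qed
  qed auto
  moreover have "integral\<^sup>L (count_space UNIV) (s m)
      = (\<Prod>k<m. (1 - Q ^ Suc k) * ((1 - z * Q ^ k) * (1 - Q ^ Suc k / z)))" for m
  proof -
    have "infsetsum (s m) UNIV = infsetsum (s m) {-int m..int m}"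
    proof (rule infsetsum_cong_neutral)
      fix j assume "j \<in> UNIV - {-int m..int m}"
      hence "\<bar>j\<bar> > int m" by auto
      thus "s m j = 0" by (simp add: s_def qcoeff_eq_0)
    qed auto
    also have "\<dots> = qfact Q m * (\<Sum>j\<in>{-int m..int m}. triple_coeff Q z j * qcoeff Q m j)"
      by (simp add: s_def sum_distrib_left mult_ac)
    also have "\<dots> = (\<Prod>k<m. (1 - Q ^ Suc k) * ((1 - z * Q ^ k) * (1 - Q ^ Suc k / z)))"
      unfolding finite_triple_product[OF Q z, symmetric] qfact_def prod.distrib ..
    finally show ?thesis by (simp only: infsetsum_def)
  qed
  ultimately show ?thesis by (simp add: infsetsum_def)
qed

section \<open>Theta series\<close>

lemma powr_powi:
  fixes x :: real
  assumes "x > 0"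
  shows "(x powr a) powi n = x powr (a * of_int n)"
proof (cases "n \<ge> 0")
  case True
  then obtain k where "n = int k" using nonneg_int_cases by blast
  thus ?thesis using assms by (simp add: powr_power mult.commute)
next
  case False
  then obtain k where "n = - int k" by (metis int_cases2 nonneg_int_cases of_nat_0_le_iff)
  thus ?thesis using assms by (simp add: power_int_minus powr_power powr_minus mult.commute)
qed

text \<open>Reindexing along the bijection followed by Fubini. In the applications \<open>c\<close>
  labels a residue class of lattice points and \<open>p\<close> runs through that class.\<close>

lemma infsetsum_partition:
  fixes f :: "'a::countable \<Rightarrow> 'b::{banach,second_countable_topology}"
    and g :: "'c \<Rightarrow> 'd::countable \<Rightarrow> 'a"
  assumes f: "f abs_summable_on UNIV" and C: "finite C"
    and bij: "bij_betw (\<lambda>(c, p). g c p) (C \<times> UNIV) UNIV"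
  shows "infsetsum f UNIV = (\<Sum>c\<in>C. infsetsum (\<lambda>p. f (g c p)) UNIV)"
proof -
  have s: "(\<lambda>x. f (case x of (c, p) \<Rightarrow> g c p)) abs_summable_on (C \<times> UNIV)"
    using f by (subst abs_summable_on_reindex_bij_betw[OF bij])
  have "infsetsum f UNIV = infsetsum (\<lambda>x. f (case x of (c, p) \<Rightarrow> g c p)) (C \<times> UNIV)"
    by (rule infsetsum_reindex_bij_betw[OF bij, symmetric])
  also have "\<dots> = infsetsum (\<lambda>c. infsetsum (\<lambda>p. f (g c p)) UNIV) C"
    using s C by (subst infsetsum_Times) (auto intro: countable_finite)
  finally show ?thesis using C by simp
qed

locale nome =
  fixes q :: real
  assumes q_pos: "0 < q" and q_less_1: "q < 1"
begin

text \<open>Exponents are kept as completed squares with real shifts, so that a product of two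
  series can be transformed by an identity between quadratic forms.\<close>

definition theta :: "real \<Rightarrow> real \<Rightarrow> real" where
  "theta \<kappa> c = infsetsum (\<lambda>n::int. (-1) powi n * q powr (\<kappa> * (of_int n + c)\<^sup>2)) UNIV"

text \<open>Expanding the square splits off a constant power of \<open>q\<close>; what remains is a
  term of a triple product series, so summability and product formulas carry over.\<close>

lemma theta_term:
  "(-1) powi n * q powr (\<kappa> * (of_int n + c)\<^sup>2)
     = q powr (\<kappa> * c\<^sup>2) * triple_coeff (q powr (2 * \<kappa>)) (q powr (\<kappa> * (1 + 2 * c))) n"
proof -
  have "even (n * (n - 1))" by simp
  hence e: "real_of_int (n * (n - 1) div 2) = of_int n * (of_int n - 1) / 2"
    by (simp add: real_of_int_div)
  have "(- (q powr (\<kappa> * (1 + 2 * c)))) powi n = (-1) powi n * (q powr (\<kappa> * (1 + 2 * c))) powi n"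
    by (subst power_int_mult_distrib[symmetric]) simp
  hence "triple_coeff (q powr (2 * \<kappa>)) (q powr (\<kappa> * (1 + 2 * c))) n
      = (-1) powi n * (q powr (\<kappa> * (1 + 2 * c) * of_int n) * q powr (2 * \<kappa> * (of_int n * (of_int n - 1) / 2)))"
    unfolding triple_coeff_def powr_powi[OF q_pos] e by simp
  also have "q powr (\<kappa> * c\<^sup>2) * \<dots> = (-1) powi n *
      q powr (\<kappa> * c\<^sup>2 + \<kappa> * (1 + 2 * c) * of_int n + 2 * \<kappa> * (of_int n * (of_int n - 1) / 2))"
    by (simp add: powr_add)
  also have "\<kappa> * c\<^sup>2 + \<kappa> * (1 + 2 * c) * of_int n + 2 * \<kappa> * (of_int n * (of_int n - 1) / 2)
      = \<kappa> * (of_int n + c)\<^sup>2"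
    by (simp add: power2_eq_square field_simps)
  finally show ?thesis ..
qed

lemma gauss_summable:
  assumes "\<kappa> > 0"
  shows "(\<lambda>n::int. q powr (\<kappa> * (of_int n + c)\<^sup>2)) abs_summable_on UNIV"
    and "(\<lambda>n::int. (-1) powi n * q powr (\<kappa> * (of_int n + c)\<^sup>2)) abs_summable_on UNIV"
proof -
  have "q powr (2 * \<kappa>) < q powr 0"
    using q_pos q_less_1 assms by (intro powr_less_mono') auto
  hence "triple_coeff (q powr (2 * \<kappa>)) (q powr (\<kappa> * (1 + 2 * c))) abs_summable_on UNIV"
    using q_pos by (intro triple_coeff_abs_summable) auto
  thus *: "(\<lambda>n::int. (-1) powi n * q powr (\<kappa> * (of_int n + c)\<^sup>2)) abs_summable_on UNIV"
    unfolding theta_term by (intro abs_summable_on_cmult_right)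
  have "norm ((-1) powi n * q powr (\<kappa> * (of_int n + c)\<^sup>2)) = q powr (\<kappa> * (of_int n + c)\<^sup>2)" for n :: int
    by (simp add: abs_mult power_int_abs)
  thus "(\<lambda>n::int. q powr (\<kappa> * (of_int n + c)\<^sup>2)) abs_summable_on UNIV"
    using abs_summable_on_normI[OF *] by simp
qed

lemma theta_uminus: "theta \<kappa> (- c) = theta \<kappa> c"
proof -
  have bij: "bij_betw uminus UNIV (UNIV :: int set)"
    by (rule bij_betwI[where g = uminus]) auto
  have "theta \<kappa> (- c) = infsetsum (\<lambda>n::int. (-1) powi (- n) * q powr (\<kappa> * (of_int (- n) + - c)\<^sup>2)) UNIV"
    unfolding theta_def by (rule infsetsum_reindex_bij_betw[OF bij, symmetric])
  also have "\<dots> = theta \<kappa> c"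
    unfolding theta_def
    by (rule infsetsum_cong) (auto simp: power_int_minus power2_eq_square algebra_simps simp flip: power_int_inverse)
  finally show ?thesis .
qed

lemma theta_plus_1: "theta \<kappa> (c + 1) = - theta \<kappa> c"
proof -
  have bij: "bij_betw (\<lambda>n. n - 1) UNIV (UNIV :: int set)"
    by (rule bij_betwI[where g = "\<lambda>n. n + 1"]) auto
  have "theta \<kappa> (c + 1) = infsetsum (\<lambda>n::int. (-1) powi (n - 1) * q powr (\<kappa> * (of_int (n - 1) + (c + 1))\<^sup>2)) UNIV"
    unfolding theta_def by (rule infsetsum_reindex_bij_betw[OF bij, symmetric])
  also have "\<dots> = infsetsum (\<lambda>n::int. - ((-1) powi n * q powr (\<kappa> * (of_int n + c)\<^sup>2))) UNIV"
    by (rule infsetsum_cong) (auto simp: power_int_diff)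
  also have "\<dots> = - theta \<kappa> c"
    unfolding theta_def by (rule infsetsum_uminus)
  finally show ?thesis .
qed

subsection \<open>The three-term relation\<close>

text \<open>The function \<open>F\<close> of the overview. The shift by 1/2 centres it so that it is
  odd in \<open>a\<close> and symmetric about 30.\<close>

definition theta60 :: "real \<Rightarrow> real" where
  "theta60 a = theta 30 (a / 60 - 1 / 2)"

lemma theta60_uminus: "theta60 (- a) = - theta60 a"
proof -
  have "theta60 (- a) = theta 30 (- (a / 60 - 1 / 2 + 1))"
    unfolding theta60_def by (rule arg_cong[where f = "theta 30"]) (simp add: field_simps)
  thus ?thesis by (simp only: theta_uminus theta_plus_1 theta60_def)
qed

lemma theta60_reflect: "theta60 (60 - a) = theta60 a"
proof -
  have "theta60 (60 - a) = theta 30 (- (a / 60 - 1 / 2))"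
    unfolding theta60_def by (rule arg_cong[where f = "theta 30"]) (simp add: field_simps)
  thus ?thesis by (simp only: theta_uminus theta60_def)
qed

text \<open>For \<open>i\<close> equal to 0 or 1 the sum runs over the indices of one parity; the
  two values are the entries of a column of the determinants below.\<close>

definition half_theta :: "int \<Rightarrow> real \<Rightarrow> real" where
  "half_theta i x = infsetsum (\<lambda>k::int. q powr (15 * (of_int (2 * k + i) + x / 30)\<^sup>2)) UNIV"

lemma half_theta_summable:
  "(\<lambda>k::int. q powr (15 * (of_int (2 * k + i) + x / 30)\<^sup>2)) abs_summable_on UNIV"
proof -
  have "15 * (of_int (2 * k + i) + x / 30)\<^sup>2 = 60 * (of_int k + (of_int i / 2 + x / 60))\<^sup>2" for k :: int
    by (simp add: power2_eq_square field_simps)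
  thus ?thesis using gauss_summable(1)[of 60] by simp
qed

text \<open>The parallelogram law rewrites the sum of two squares through the sum and difference of
  the indices \<open>m\<close> and \<open>n\<close>, which have equal parity. The sign depends only
  on that parity, so the two parity classes give the two terms of a determinant.\<close>

lemma theta60_mult:
  "theta60 (x + y) * theta60 (x - y) = half_theta 1 x * half_theta 0 y - half_theta 0 x * half_theta 1 y"
proof -
  define c d where "c = (x + y) / 60 - 1 / 2" and "d = (x - y) / 60 - 1 / 2"
  define h where "h = (\<lambda>(m::int, n::int). ((-1) powi m * q powr (30 * (of_int m + c)\<^sup>2))
      * ((-1) powi n * q powr (30 * (of_int n + d)\<^sup>2)))"
  \<comment> \<open>Here \<open>m + n = 2 * k + 2 - e\<close> and \<open>m - n = 2 * l + e\<close>;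
    the offset 1 in each coordinate compensates for the two shifts by 1/2 in \<open>c\<close> and
    \<open>d\<close>.\<close>
  define g where "g = (\<lambda>(e::int) (k::int, l::int). (k + l + 1, k - l + 1 - e))"
  have hs: "h abs_summable_on UNIV"
    using abs_summable_on_product[OF _ _ gauss_summable(2)[of 30 c] gauss_summable(2)[of 30 d]]
    by (simp add: h_def)
  have "theta60 (x + y) * theta60 (x - y) = infsetsum h (UNIV \<times> UNIV)"
    unfolding theta60_def theta_def c_def[symmetric] d_def[symmetric] h_def
    by (rule infsetsum_product[symmetric]) (auto intro: gauss_summable)
  also have "\<dots> = infsetsum h UNIV" by simp
  also have "\<dots> = (\<Sum>e\<in>{0,1}. infsetsum (\<lambda>p. h (g e p)) UNIV)"
  proof (rule infsetsum_partition[OF hs])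
    show "bij_betw (\<lambda>(e, p). g e p) ({0, 1} \<times> UNIV) UNIV"
    proof (rule bij_betwI[where g = "\<lambda>(m, n). ((m + n) mod 2, ((m + n) div 2 + (m + n) mod 2 - 1, m - (m + n) div 2 - (m + n) mod 2))"])
      show "(\<lambda>(e, p). g e p) \<in> {0, 1} \<times> UNIV \<rightarrow> UNIV" by auto
      show "(\<lambda>(m, n). ((m + n) mod 2, (m + n) div 2 + (m + n) mod 2 - 1, m - (m + n) div 2 - (m + n) mod 2))
          \<in> UNIV \<rightarrow> {0, 1::int} \<times> UNIV" by auto
      fix z :: "int \<times> int \<times> int" assume "z \<in> {0, 1} \<times> UNIV"
      then obtain e k l where z: "z = (e, k, l)" "e = 0 \<or> e = 1" by (cases z) auto
      have "k + l + 1 + (k - l + 1 - e) = 2 * (k + 1) - e" by simp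
      with z(2) show "(\<lambda>(m, n). ((m + n) mod 2, (m + n) div 2 + (m + n) mod 2 - 1, m - (m + n) div 2 - (m + n) mod 2))
          ((\<lambda>(e, p). g e p) z) = z"
        unfolding z(1) g_def by (elim disjE; simp; presburger)
    next
      fix p :: "int \<times> int" assume "p \<in> UNIV"
      obtain m n where p: "p = (m, n)" by (cases p)
      show "(\<lambda>(e, p). g e p) ((\<lambda>(m, n). ((m + n) mod 2, (m + n) div 2 + (m + n) mod 2 - 1, m - (m + n) div 2 - (m + n) mod 2)) p) = p"
        unfolding p g_def by simp presburger
    qed
  qed auto
  also have "\<dots> = infsetsum (\<lambda>p. h (g 0 p)) UNIV + infsetsum (\<lambda>p. h (g 1 p)) UNIV"
    by simp
  also have "(\<lambda>p. h (g 0 p)) = (\<lambda>(k, l). q powr (15 * (of_int (2 * k + 1) + x / 30)\<^sup>2)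
                                  * q powr (15 * (of_int (2 * l + 0) + y / 30)\<^sup>2))"
  proof (rule ext, clarify)
    fix k l :: int
    have s: "(-1) powi (k + l + 1) * (-1) powi (k - l + 1) = (1::real)"
      by (simp add: power_int_add[symmetric] power_int_minus_left)
    have e: "30 * (of_int (k + l + 1) + c)\<^sup>2 + 30 * (of_int (k - l + 1) + d)\<^sup>2
        = 15 * (of_int (2 * k + 1) + x / 30)\<^sup>2 + 15 * (of_int (2 * l + 0) + y / 30)\<^sup>2"
      by (simp add: c_def d_def power2_eq_square field_simps)
    have "h (g 0 (k, l)) = ((-1) powi (k + l + 1) * (-1) powi (k - l + 1))
        * (q powr (30 * (of_int (k + l + 1) + c)\<^sup>2 + 30 * (of_int (k - l + 1) + d)\<^sup>2))"
      by (simp add: h_def g_def powr_add mult_ac)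
    thus "h (g 0 (k, l)) = q powr (15 * (of_int (2 * k + 1) + x / 30)\<^sup>2)
                                  * q powr (15 * (of_int (2 * l + 0) + y / 30)\<^sup>2)"
      unfolding s e by (simp add: powr_add)
  qed
  also have "infsetsum \<dots> UNIV = half_theta 1 x * half_theta 0 y"
    using infsetsum_product[OF _ _ half_theta_summable[of 1 x] half_theta_summable[of 0 y]]
    by (simp add: half_theta_def)
  also have "(\<lambda>p. h (g 1 p)) = (\<lambda>(k, l). - (q powr (15 * (of_int (2 * k + 0) + x / 30)\<^sup>2)
                                  * q powr (15 * (of_int (2 * l + 1) + y / 30)\<^sup>2)))"
  proof (rule ext, clarify)
    fix k l :: int
    have s: "(-1) powi (k + l + 1) * (-1) powi (k - l) = (-1::real)"
      by (simp add: power_int_add[symmetric] power_int_minus_left)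
    have e: "30 * (of_int (k + l + 1) + c)\<^sup>2 + 30 * (of_int (k - l) + d)\<^sup>2
        = 15 * (of_int (2 * k + 0) + x / 30)\<^sup>2 + 15 * (of_int (2 * l + 1) + y / 30)\<^sup>2"
      by (simp add: c_def d_def power2_eq_square field_simps)
    have "h (g 1 (k, l)) = ((-1) powi (k + l + 1) * (-1) powi (k - l))
        * (q powr (30 * (of_int (k + l + 1) + c)\<^sup>2 + 30 * (of_int (k - l) + d)\<^sup>2))"
      by (simp add: h_def g_def powr_add mult_ac)
    thus "h (g 1 (k, l)) = - (q powr (15 * (of_int (2 * k + 0) + x / 30)\<^sup>2)
                                  * q powr (15 * (of_int (2 * l + 1) + y / 30)\<^sup>2))"
      unfolding s e by (simp add: powr_add)
  qed
  also have "infsetsum \<dots> UNIV = - infsetsum (\<lambda>(k, l). q powr (15 * (of_int (2 * k + 0) + x / 30)\<^sup>2)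
                                  * q powr (15 * (of_int (2 * l + 1) + y / 30)\<^sup>2)) UNIV"
    by (subst infsetsum_uminus[symmetric]) (simp add: case_prod_unfold)
  also have "infsetsum (\<lambda>(k, l). q powr (15 * (of_int (2 * k + 0) + x / 30)\<^sup>2)
                 * q powr (15 * (of_int (2 * l + 1) + y / 30)\<^sup>2)) UNIV = half_theta 0 x * half_theta 1 y"
    using infsetsum_product[OF _ _ half_theta_summable[of 0 x] half_theta_summable[of 1 y]]
    by (simp add: half_theta_def)
  finally show ?thesis by simp
qed

text \<open>Each factor pair is a minor of the 2 by 4 matrix of \<open>half_theta\<close> values at
  \<open>x\<close>, \<open>y\<close>, \<open>u\<close>, \<open>v\<close>. The Pluecker relation
  between complementary minors is a polynomial identity.\<close>

theorem weierstrass_three_term: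
  "theta60 (x + y) * theta60 (x - y) * (theta60 (u + v) * theta60 (u - v)) - theta60 (x + u) * theta60 (x - u) * (theta60 (y + v) * theta60 (y - v))
     + theta60 (x + v) * theta60 (x - v) * (theta60 (y + u) * theta60 (y - u)) = 0"
  unfolding theta60_mult by algebra

end

section \<open>Products over arithmetic progressions\<close>

context nome
begin

text \<open>The infinite q-Pochhammer product with first factor \<open>1 - q ^ r\<close> and step
  \<open>q ^ M\<close>.\<close>

definition prog :: "nat \<Rightarrow> nat \<Rightarrow> real" where
  "prog M r = prodinf (\<lambda>k. 1 - q ^ (M * k + r))"

lemma q_power_less_1: "n > 0 \<Longrightarrow> q ^ n < 1"
  using q_pos q_less_1 by (simp add: power_less_one_iff)

lemma
  assumes "M > 0" "r > 0"
  shows prog_tendsto: "(\<lambda>m. \<Prod>k<m. 1 - q ^ (M * k + r)) \<longlonglongrightarrow> prog M r"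
    and prog_nonzero: "prog M r \<noteq> 0"
proof -
  have "summable (\<lambda>k. q ^ k)"
    using q_pos q_less_1 by (simp add: summable_geometric)
  hence "summable (\<lambda>k. norm ((1 - q ^ (M * k + r)) - 1))"
  proof (rule summable_comparison_test')
    fix k :: nat
    have "k \<le> M * k + r" using assms by (simp add: trans_le_add1)
    thus "norm (norm ((1 - q ^ (M * k + r)) - 1)) \<le> q ^ k"
      using q_pos q_less_1 by (simp add: power_decreasing)
  qed
  hence c: "convergent_prod (\<lambda>k. 1 - q ^ (M * k + r))"
    by (intro abs_convergent_prod_imp_convergent_prod summable_imp_abs_convergent_prod)
  show "(\<lambda>m. \<Prod>k<m. 1 - q ^ (M * k + r)) \<longlonglongrightarrow> prog M r"
    using convergent_prod_LIMSEQ[OF c] unfolding LIMSEQ_lessThan_iff_atMost prog_def .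
  show "prog M r \<noteq> 0"
    unfolding prog_def
  proof (rule prodinf_nonzero[OF c])
    fix k show "1 - q ^ (M * k + r) \<noteq> 0"
      using q_power_less_1[of "M * k + r"] assms by simp
  qed
qed

text \<open>Sorting the factors by the residue of \<open>k\<close> modulo \<open>d\<close> refines
  the progression; this brings products of different moduli to a common one.\<close>

lemma prog_split:
  assumes "M > 0" "r > 0" "d > 0"
  shows "prog M r = (\<Prod>j<d. prog (M * d) (M * j + r))"
proof -
  have fin: "(\<Prod>k<m * d. 1 - q ^ (M * k + r)) = (\<Prod>j<d. \<Prod>k<m. 1 - q ^ (M * d * k + (M * j + r)))" for m
  proof -
    have "(\<Prod>k<m * d. 1 - q ^ (M * k + r)) = (\<Prod>k<m. \<Prod>i\<in>{k * d..<k * d + d}. 1 - q ^ (M * i + r))"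
      by (rule prod.nat_group[symmetric])
    also have "\<dots> = (\<Prod>k<m. \<Prod>j<d. 1 - q ^ (M * d * k + (M * j + r)))"
    proof (rule prod.cong[OF refl])
      fix k
      show "(\<Prod>i\<in>{k * d..<k * d + d}. 1 - q ^ (M * i + r)) = (\<Prod>j<d. 1 - q ^ (M * d * k + (M * j + r)))"
        by (subst prod.atLeastLessThan_shift_0) (simp add: lessThan_atLeast0 algebra_simps)
    qed
    also have "\<dots> = (\<Prod>j<d. \<Prod>k<m. 1 - q ^ (M * d * k + (M * j + r)))"
      by (rule prod.swap)
    finally show ?thesis .
  qed
  have "filterlim (\<lambda>m::nat. m * d) at_top sequentially"
    using assms by (intro filterlim_subseq) (auto simp: strict_mono_def)
  hence "(\<lambda>m. \<Prod>k<m * d. 1 - q ^ (M * k + r)) \<longlonglongrightarrow> prog M r"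
    using filterlim_compose[OF prog_tendsto[OF assms(1,2)]] by blast
  moreover have "(\<lambda>m. \<Prod>j<d. \<Prod>k<m. 1 - q ^ (M * d * k + (M * j + r))) \<longlonglongrightarrow> (\<Prod>j<d. prog (M * d) (M * j + r))"
    using assms by (intro tendsto_prod prog_tendsto) auto
  ultimately show ?thesis
    unfolding fin using LIMSEQ_unique by blast
qed

text \<open>Triple product with base \<open>q ^ M\<close> and \<open>z = q ^ a\<close>. The shift
  \<open>a / M - 1 / 2\<close> is the one for which the linear exponent
  \<open>M / 2 * (1 + 2 * c)\<close> equals \<open>a\<close>.\<close>

lemma theta_product:
  assumes a: "0 < a" "a < M"
  shows "theta (real M / 2) (real a / real M - 1 / 2)
     = q powr (real M / 2 * (real a / real M - 1 / 2)\<^sup>2) * (prog M M * (prog M a * prog M (M - a)))"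
proof -
  define c where "c = real a / real M - 1 / 2"
  have Q: "q powr (2 * (real M / 2)) = q ^ M" 
    using q_pos by (simp add: powr_realpow)
  have "real M / 2 * (1 + 2 * c) = real a"
    using a by (simp add: c_def field_simps)
  hence z: "q powr (real M / 2 * (1 + 2 * c)) = q ^ a"
    using q_pos by (simp add: powr_realpow)
  have M: "M > 0" using a by simp
  have "(\<lambda>m. \<Prod>k<m. (1 - (q ^ M) ^ Suc k) * ((1 - q ^ a * (q ^ M) ^ k) * (1 - (q ^ M) ^ Suc k / q ^ a)))
      \<longlonglongrightarrow> infsetsum (triple_coeff (q ^ M) (q ^ a)) UNIV"
    using q_pos q_power_less_1[OF M] by (intro jacobi_triple_product) auto
  moreover have "(\<lambda>m. \<Prod>k<m. (1 - (q ^ M) ^ Suc k) * ((1 - q ^ a * (q ^ M) ^ k) * (1 - (q ^ M) ^ Suc k / q ^ a)))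
      \<longlonglongrightarrow> prog M M * (prog M a * prog M (M - a))"
  proof -
    have eq: "(1 - (q ^ M) ^ Suc k) * ((1 - q ^ a * (q ^ M) ^ k) * (1 - (q ^ M) ^ Suc k / q ^ a))
        = (1 - q ^ (M * k + M)) * ((1 - q ^ (M * k + a)) * (1 - q ^ (M * k + (M - a))))" for k
    proof -
      have "(q ^ M) ^ Suc k = q ^ (M * k + M)"
        by (simp add: power_add power_mult)
      moreover have "q ^ a * (q ^ M) ^ k = q ^ (M * k + a)"
        by (simp add: power_add power_mult)
      moreover have "q ^ (M * k + M) = q ^ (M * k + (M - a)) * q ^ a"
        using a by (simp add: power_add[symmetric])
      ultimately show ?thesis using q_pos by simp
    qed
    show ?thesis
      unfolding eq prod.distrib by (intro tendsto_mult prog_tendsto) (use a in auto)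
  qed
  ultimately have "infsetsum (triple_coeff (q ^ M) (q ^ a)) UNIV = prog M M * (prog M a * prog M (M - a))"
    using LIMSEQ_unique by blast
  moreover have "theta (real M / 2) c = q powr (real M / 2 * c\<^sup>2) * infsetsum (triple_coeff (q ^ M) (q ^ a)) UNIV"
    unfolding theta_def theta_term Q z
    using q_pos q_power_less_1[OF M] by (intro infsetsum_cmult_right triple_coeff_abs_summable) auto
  ultimately show ?thesis by (simp add: c_def)
qed

section \<open>A double theta series twisted by a cube root of unity\<close>

text \<open>The value at 1/2 equals the value at -1/2 by reflection and its negative by
  translation.\<close>

lemma theta_half: "theta \<kappa> (1 / 2) = 0"
  using theta_plus_1[of \<kappa> "- (1 / 2)"] theta_uminus[of \<kappa> "1 / 2"] by simp

lemma theta_one_minus: "theta \<kappa> (1 - c) = - theta \<kappa> c"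
  using theta_plus_1[of \<kappa> "- c"] theta_uminus[of \<kappa> c] by simp

context
  fixes \<omega> :: complex
  assumes w2: "\<omega>\<^sup>2 + \<omega> + 1 = 0"
begin

lemma w3: "\<omega> ^ 3 = 1"
proof -
  have "\<omega> ^ 3 - 1 = (\<omega> - 1) * (\<omega>\<^sup>2 + \<omega> + 1)"
    by (simp add: power2_eq_square power3_eq_cube algebra_simps)
  thus ?thesis using w2 by simp
qed

lemma w0: "\<omega> \<noteq> 0"
  using w2 by auto

lemma norm_q_power: "n > 0 \<Longrightarrow> cmod (of_real q ^ n) < 1"
  using q_pos q_power_less_1[of n] by (simp add: norm_power)

text \<open>With \<open>twist2\<close> this factors the summand of the double series, since the
  twist by the power \<open>n - m\<close> of \<open>\<omega>\<close> separates.\<close>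

definition twist1 :: "int \<Rightarrow> complex" where
  "twist1 n = \<omega> powi n * of_real (q powr (of_int n)\<^sup>2)"

definition twist2 :: "int \<Rightarrow> complex" where
  "twist2 n = (-1) powi n * \<omega> powi (- n) * of_real (q powr (5 * (of_int n)\<^sup>2))"

lemma of_real_powr_powi:
  "of_real (q powr x) powi n = (of_real (q powr (x * of_int n)) :: complex)"
  by (simp only: of_real_power_int[symmetric] powr_powi[OF q_pos])

lemma twist1_conv: "twist1 = triple_coeff (of_real (q powr 2)) (- \<omega> * of_real (q powr 1))"
proof
  fix n :: int
  have "even (n * (n - 1))" by simp
  hence e: "real_of_int (n * (n - 1) div 2) = of_int n * (of_int n - 1) / 2"
    by (simp add: real_of_int_div)
  have "triple_coeff (of_real (q powr 2)) (- \<omega> * of_real (q powr 1)) n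
      = \<omega> powi n * (of_real (q powr (1 * of_int n)) * of_real (q powr (2 * (of_int n * (of_int n - 1) / 2))))"
    unfolding triple_coeff_def
    by (simp only: mult_minus_left minus_minus power_int_mult_distrib of_real_powr_powi e mult_ac)
  also have "\<dots> = \<omega> powi n * of_real (q powr (1 * of_int n + 2 * (of_int n * (of_int n - 1) / 2)))"
    by (simp only: powr_add of_real_mult)
  also have "1 * of_int n + 2 * (of_int n * (of_int n - 1) / 2) = (real_of_int n)\<^sup>2"
    by (simp add: power2_eq_square field_simps)
  finally show "twist1 n = triple_coeff (of_real (q powr 2)) (- \<omega> * of_real (q powr 1)) n"
    by (simp add: twist1_def)
qed

lemma twist2_conv: "twist2 = triple_coeff (of_real (q powr 10)) (inverse \<omega> * of_real (q powr 5))"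
proof
  fix n :: int
  have "even (n * (n - 1))" by simp
  hence e: "real_of_int (n * (n - 1) div 2) = of_int n * (of_int n - 1) / 2"
    by (simp add: real_of_int_div)
  have s: "- (inverse \<omega> * of_real (q powr 5)) = (-1) * (inverse \<omega> * of_real (q powr 5))"
    by simp
  have "triple_coeff (of_real (q powr 10)) (inverse \<omega> * of_real (q powr 5)) n
      = (-1) powi n * (\<omega> powi (- n) * (of_real (q powr (5 * of_int n)) * of_real (q powr (10 * (of_int n * (of_int n - 1) / 2)))))"
    unfolding triple_coeff_def s
    by (simp only: power_int_mult_distrib of_real_powr_powi e mult.assoc power_int_inverse power_int_minus)
  also have "\<dots> = (-1) powi n * (\<omega> powi (- n) * of_real (q powr (5 * of_int n + 10 * (of_int n * (of_int n - 1) / 2))))"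
    by (simp only: powr_add of_real_mult)
  also have "5 * of_int n + 10 * (of_int n * (of_int n - 1) / 2) = 5 * (real_of_int n)\<^sup>2"
    by (simp add: power2_eq_square field_simps)
  finally show "twist2 n = triple_coeff (of_real (q powr 10)) (inverse \<omega> * of_real (q powr 5)) n"
    by (simp add: twist2_def)
qed

lemma twist_summable: "twist1 abs_summable_on UNIV" "twist2 abs_summable_on UNIV"
  unfolding twist1_conv twist2_conv
  using w0 q_pos by (intro triple_coeff_abs_summable; simp add: norm_q_power)+

text \<open>Conjugate factors of the triple product multiply to \<open>1 - x + x\<^sup>2\<close>
  with \<open>x = q ^ (2 * k + 1)\<close>, a cyclotomic quotient of factors
  \<open>1 - x ^ j\<close>. Thus \<open>\<omega>\<close> disappears.\<close>

lemma twist1_product: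
  "infsetsum twist1 UNIV
     = of_real (prog 2 2 * (prog 12 6 * prog 2 1 / (prog 6 3 * prog 4 2)))"
proof -
  have w': "1 / \<omega> = \<omega>\<^sup>2" using w3 w0 by (simp add: field_simps power2_eq_square power3_eq_cube)
  have p: "q powr 2 = q ^ 2" "q powr 1 = q" using q_pos by (simp_all add: powr_numeral)
  have "(\<lambda>m. \<Prod>k<m. (1 - of_real (q powr 2) ^ Suc k) * ((1 - (- \<omega> * of_real (q powr 1)) * of_real (q powr 2) ^ k)
      * (1 - of_real (q powr 2) ^ Suc k / (- \<omega> * of_real (q powr 1))))) \<longlonglongrightarrow> infsetsum twist1 UNIV"
    unfolding twist1_conv using w0 q_pos by (intro jacobi_triple_product; simp add: norm_q_power)
  moreover have "(1 - of_real (q powr 2) ^ Suc k) * ((1 - (- \<omega> * of_real (q powr 1)) * of_real (q powr 2) ^ k)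
      * (1 - of_real (q powr 2) ^ Suc k / (- \<omega> * of_real (q powr 1))))
      = of_real ((1 - q ^ (2 * k + 2)) * ((1 - q ^ (12 * k + 6)) * (1 - q ^ (2 * k + 1)) /
         ((1 - q ^ (6 * k + 3)) * (1 - q ^ (4 * k + 2)))))" for k
  proof -
    define x where "x = q ^ (2 * k + 1)"
    have x: "0 < x" "x < 1" using q_pos q_power_less_1[of "2 * k + 1"] by (simp_all add: x_def)
    have xp: "q ^ (12 * k + 6) = x ^ 6" "q ^ (6 * k + 3) = x ^ 3" "q ^ (4 * k + 2) = x ^ 2"
      unfolding x_def power_mult[symmetric] by (simp_all only: add_mult_distrib) simp_all
    have x3: "x ^ 3 < 1" "x ^ 2 < 1" using x by (simp_all add: power_less_one_iff)
    have "(1 - x ^ 6) * (1 - x) = (1 - x + x\<^sup>2) * ((1 - x ^ 3) * (1 - x ^ 2))"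
      by algebra
    hence r: "(1 - x ^ 6) * (1 - x) / ((1 - x ^ 3) * (1 - x ^ 2)) = 1 - x + x\<^sup>2"
      using x3 by (subst nonzero_divide_eq_eq) auto
    have "(q\<^sup>2) ^ Suc k = q ^ (2 * k + 2)"
      by (simp only: power_mult[symmetric]) simp
    hence q2: "of_real (q\<^sup>2) ^ Suc k = (of_real (q ^ (2 * k + 2)) :: complex)"
      by (simp only: of_real_power[symmetric])
    have "(1 - (- \<omega> * of_real q) * of_real (q\<^sup>2) ^ k) = 1 + \<omega> * of_real x"
      by (simp add: x_def power_mult[symmetric] power_add)
    moreover have "(1 - of_real (q\<^sup>2) ^ Suc k / (- \<omega> * of_real q)) = 1 + \<omega>\<^sup>2 * of_real x"
    proof -
      have "of_real (q\<^sup>2) ^ Suc k / (- \<omega> * of_real q) = - ((1 / \<omega>) * of_real (q ^ (2 * k + 2) / q))"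
        unfolding q2 by simp
      also have "q ^ (2 * k + 2) / q = x"
        using q_pos by (simp add: x_def)
      finally show ?thesis by (simp add: w')
    qed
    moreover have "(1 + \<omega> * of_real x) * (1 + \<omega>\<^sup>2 * of_real x) = of_real (1 - x + x\<^sup>2)"
    proof -
      have "(1 + \<omega> * of_real x) * (1 + \<omega>\<^sup>2 * of_real x)
          = 1 + (\<omega>\<^sup>2 + \<omega>) * of_real x + \<omega> ^ 3 * (of_real x)\<^sup>2"
        by (simp add: power2_eq_square power3_eq_cube algebra_simps)
      also have "\<omega>\<^sup>2 + \<omega> = -1" using w2 by (simp add: add_eq_0_iff2)
      finally show ?thesis by (simp add: w3)
    qed
    moreover have "1 - of_real (q\<^sup>2) ^ Suc k = (of_real (1 - q ^ (2 * k + 2)) :: complex)"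
      unfolding q2 by simp
    ultimately show ?thesis
      unfolding p xp r x_def[symmetric] by (simp only: of_real_mult)
  qed
  ultimately have "(\<lambda>m. of_real (\<Prod>k<m. (1 - q ^ (2 * k + 2)) * ((1 - q ^ (12 * k + 6)) * (1 - q ^ (2 * k + 1)) /
         ((1 - q ^ (6 * k + 3)) * (1 - q ^ (4 * k + 2))))) :: complex) \<longlonglongrightarrow> infsetsum twist1 UNIV"
    by simp
  moreover have "(\<lambda>m. of_real (\<Prod>k<m. (1 - q ^ (2 * k + 2)) * ((1 - q ^ (12 * k + 6)) * (1 - q ^ (2 * k + 1)) /
         ((1 - q ^ (6 * k + 3)) * (1 - q ^ (4 * k + 2))))) :: complex)
      \<longlonglongrightarrow> of_real (prog 2 2 * (prog 12 6 * prog 2 1 / (prog 6 3 * prog 4 2)))"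
    unfolding prod.distrib prod_dividef
    by (intro tendsto_of_real tendsto_mult tendsto_divide prog_tendsto) (auto simp: prog_nonzero)
  ultimately show ?thesis using LIMSEQ_unique by blast
qed

text \<open>Here the conjugate factors multiply to \<open>1 + x + x\<^sup>2\<close>, the quotient of
  \<open>1 - x ^ 3\<close> by \<open>1 - x\<close>, with
  \<open>x = q ^ (10 * k + 5)\<close>.\<close>

lemma twist2_product:
  "infsetsum twist2 UNIV = of_real (prog 10 10 * (prog 30 15 / prog 10 5))"
proof -
  have w': "1 / \<omega> = \<omega>\<^sup>2" using w3 w0 by (simp add: field_simps power2_eq_square power3_eq_cube)
  have p: "q powr 10 = q ^ 10" "q powr 5 = q ^ 5" using q_pos by (simp_all add: powr_numeral)
  have "(\<lambda>m. \<Prod>k<m. (1 - of_real (q powr 10) ^ Suc k) * ((1 - (inverse \<omega> * of_real (q powr 5)) * of_real (q powr 10) ^ k)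
      * (1 - of_real (q powr 10) ^ Suc k / (inverse \<omega> * of_real (q powr 5))))) \<longlonglongrightarrow> infsetsum twist2 UNIV"
    unfolding twist2_conv using w0 q_pos by (intro jacobi_triple_product; simp add: norm_q_power)
  moreover have "(1 - of_real (q powr 10) ^ Suc k) * ((1 - (inverse \<omega> * of_real (q powr 5)) * of_real (q powr 10) ^ k)
      * (1 - of_real (q powr 10) ^ Suc k / (inverse \<omega> * of_real (q powr 5))))
      = of_real ((1 - q ^ (10 * k + 10)) * ((1 - q ^ (30 * k + 15)) / (1 - q ^ (10 * k + 5))))" for k
  proof -
    define x where "x = q ^ (10 * k + 5)"
    have x: "0 < x" "x < 1" using q_pos q_power_less_1[of "10 * k + 5"] by (simp_all add: x_def)
    have xp: "q ^ (30 * k + 15) = x ^ 3"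
      unfolding x_def power_mult[symmetric] by (simp_all only: add_mult_distrib) simp_all
    have "1 - x ^ 3 = (1 + x + x\<^sup>2) * (1 - x)"
      by algebra
    hence r: "(1 - x ^ 3) / (1 - x) = 1 + x + x\<^sup>2"
      using x by (simp add: field_simps)
    have "(1 - (inverse \<omega> * of_real (q ^ 5)) * of_real (q ^ 10) ^ k) = 1 - \<omega>\<^sup>2 * of_real x"
      using w' by (simp add: x_def power_mult[symmetric] power_add inverse_eq_divide)
    moreover have "(1 - of_real (q ^ 10) ^ Suc k / (inverse \<omega> * of_real (q ^ 5))) = 1 - \<omega> * of_real x"
    proof -
      have "of_real (q ^ 10) ^ Suc k / (inverse \<omega> * of_real (q ^ 5)) = \<omega> * of_real (q ^ (10 * k + 10) / q ^ 5)"
        by (simp add: power_mult[symmetric] power_add field_simps)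
      also have "q ^ (10 * k + 10) / q ^ 5 = x"
        using q_pos by (simp add: x_def power_add field_simps)
      finally show ?thesis by simp
    qed
    moreover have "(1 - \<omega>\<^sup>2 * of_real x) * (1 - \<omega> * of_real x) = of_real (1 + x + x\<^sup>2)"
    proof -
      have "(1 - \<omega>\<^sup>2 * of_real x) * (1 - \<omega> * of_real x)
          = 1 - (\<omega>\<^sup>2 + \<omega>) * of_real x + \<omega> ^ 3 * (of_real x)\<^sup>2"
        by (simp add: power2_eq_square power3_eq_cube algebra_simps)
      also have "\<omega>\<^sup>2 + \<omega> = -1" using w2 by (simp add: add_eq_0_iff2)
      finally show ?thesis by (simp add: w3)
    qed
    moreover have "1 - of_real (q ^ 10) ^ Suc k = (of_real (1 - q ^ (10 * k + 10)) :: complex)"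
      by (simp add: power_mult[symmetric] power_add mult_ac)
    ultimately show ?thesis
      unfolding p xp x_def[symmetric] r by (simp only: of_real_mult)
  qed
  ultimately have "(\<lambda>m. of_real (\<Prod>k<m. (1 - q ^ (10 * k + 10)) * ((1 - q ^ (30 * k + 15)) / (1 - q ^ (10 * k + 5)))) :: complex)
      \<longlonglongrightarrow> infsetsum twist2 UNIV"
    by simp
  moreover have "(\<lambda>m. of_real (\<Prod>k<m. (1 - q ^ (10 * k + 10)) * ((1 - q ^ (30 * k + 15)) / (1 - q ^ (10 * k + 5)))) :: complex)
      \<longlonglongrightarrow> of_real (prog 10 10 * (prog 30 15 / prog 10 5))"
    unfolding prod.distrib prod_dividef
    by (intro tendsto_of_real tendsto_mult tendsto_divide prog_tendsto) (auto simp: prog_nonzero)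
  ultimately show ?thesis using LIMSEQ_unique by blast
qed

text \<open>With \<open>n = A + 5 * B\<close> and \<open>m = A - B\<close> the form
  \<open>n\<^sup>2 + 5 * m\<^sup>2\<close> becomes \<open>6 * A\<^sup>2 + 30 * B\<^sup>2\<close>.
  Each class of \<open>n - m\<close> modulo 6 gives a product of two theta values.\<close>

lemma twist_mult:
  "infsetsum twist1 UNIV * infsetsum twist2 UNIV
     = of_real (theta 6 0 * theta 30 0 - theta 6 (1/6) * theta 30 (1/6) - theta 6 (1/3) * theta 30 (1/3))"
proof -
  define h where "h = (\<lambda>(n, m). twist1 n * twist2 m)"
  \<comment> \<open>Here \<open>n - m = c + 6 * b\<close>, so the power of \<open>\<omega>\<close>
    depends on \<open>c\<close> alone, and both squares acquire the same shift
    \<open>c / 6\<close>.\<close>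
  define g where "g = (\<lambda>(c::int) (a::int, b::int). (a + 5 * b + c, a - b))"
  have hs: "h abs_summable_on UNIV"
    using abs_summable_on_product[OF _ _ twist_summable] by (simp add: h_def)
  have "infsetsum twist1 UNIV * infsetsum twist2 UNIV = infsetsum h UNIV"
    using infsetsum_product[OF _ _ twist_summable] by (simp add: h_def)
  also have "\<dots> = (\<Sum>c\<in>{0..<6}. infsetsum (\<lambda>p. h (g c p)) UNIV)"
  proof (rule infsetsum_partition[OF hs])
    show "bij_betw (\<lambda>(c, p). g c p) ({0..<6} \<times> UNIV) UNIV"
    proof (rule bij_betwI[where g = "\<lambda>(n, m). ((n - m) mod 6, (m + (n - m) div 6, (n - m) div 6))"])
      fix z :: "int \<times> int \<times> int" assume "z \<in> {0..<6} \<times> UNIV"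
      then obtain c a b where z: "z = (c, a, b)" "0 \<le> c" "c < 6" by (cases z) auto
      have e: "a + 5 * b + c - (a - b) = c + 6 * b" by simp
      have "(c + 6 * b) mod 6 = c" "(c + 6 * b) div 6 = b" using z by auto
      thus "(\<lambda>(n, m). ((n - m) mod 6, m + (n - m) div 6, (n - m) div 6)) ((\<lambda>(c, p). g c p) z) = z"
        unfolding z(1) g_def by (simp only: prod.case e) simp
    next
      fix p :: "int \<times> int" assume "p \<in> UNIV"
      obtain n m where p: "p = (n, m)" by (cases p)
      show "(\<lambda>(c, p). g c p) ((\<lambda>(n, m). ((n - m) mod 6, m + (n - m) div 6, (n - m) div 6)) p) = p"
        unfolding p g_def by simp
    qed auto
  qed simp
  also have "\<dots> = (\<Sum>c\<in>{0..<6}. \<omega> powi c * of_real (theta 6 (of_int c / 6) * theta 30 (of_int c / 6)))"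
  proof (rule sum.cong[OF refl])
    fix c :: int
    have hg: "h (g c (a, b)) = \<omega> powi c * of_real (((-1) powi a * q powr (6 * (of_int a + of_int c / 6)\<^sup>2)) *
        ((-1) powi b * q powr (30 * (of_int b + of_int c / 6)\<^sup>2)))" for a b
    proof -
      have w6: "\<omega> ^ 6 = 1"
      proof -
        have "\<omega> ^ 6 = (\<omega> ^ 3) ^ 2" by (simp add: power_mult[symmetric])
        thus ?thesis by (simp add: w3)
      qed
      have e6: "a + 5 * b + c + (- (a - b)) = c + 6 * b" by simp
      have "\<omega> powi (a + 5 * b + c) * \<omega> powi (- (a - b)) = \<omega> powi (a + 5 * b + c + (- (a - b)))"
        using w0 by (intro power_int_add[symmetric]) auto
      also have "\<dots> = \<omega> powi (c + 6 * b)" by (simp only: e6)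
      also have "\<dots> = \<omega> powi c"
        using w0 by (simp add: power_int_add power_int_mult w6)
      finally have w: "\<omega> powi (a + 5 * b + c) * \<omega> powi (- (a - b)) = \<omega> powi c" .
      have s: "(-1) powi (a - b) = (of_real ((-1) powi a * (-1) powi b) :: complex)"
        by (simp add: power_int_diff power_int_minus_left)
      have e: "(of_int (a + 5 * b + c))\<^sup>2 + 5 * (of_int (a - b))\<^sup>2
          = 6 * (real_of_int a + of_int c / 6)\<^sup>2 + 30 * (of_int b + of_int c / 6)\<^sup>2"
        by (simp add: power2_eq_square field_simps)
      have "h (g c (a, b)) = (\<omega> powi (a + 5 * b + c) * \<omega> powi (- (a - b))) * (-1) powi (a - b)
          * of_real (q powr ((of_int (a + 5 * b + c))\<^sup>2 + 5 * (of_int (a - b))\<^sup>2))"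
        unfolding h_def g_def twist1_def twist2_def prod.case powr_add of_real_mult by (simp only: mult_ac)
      also have "\<dots> = \<omega> powi c * of_real (((-1) powi a * (-1) powi b) *
          q powr (6 * (real_of_int a + of_int c / 6)\<^sup>2 + 30 * (of_int b + of_int c / 6)\<^sup>2))"
        unfolding w s e by (simp only: of_real_mult mult_ac)
      also have "\<dots> = \<omega> powi c * of_real (((-1) powi a * q powr (6 * (of_int a + of_int c / 6)\<^sup>2)) *
        ((-1) powi b * q powr (30 * (of_int b + of_int c / 6)\<^sup>2)))"
        unfolding powr_add by (simp only: mult_ac)
      finally show ?thesis .
    qed
    define k where "k = (\<lambda>(a::int, b::int). ((-1) powi a * q powr (6 * (of_int a + of_int c / 6)\<^sup>2)) *
        ((-1) powi b * q powr (30 * (of_int b + of_int c / 6)\<^sup>2)))"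
    have ks: "k abs_summable_on UNIV"
      using abs_summable_on_product[OF _ _ gauss_summable(2)[of 6 "of_int c / 6"] gauss_summable(2)[of 30 "of_int c / 6"]]
      by (simp add: k_def)
    have "infsetsum k UNIV = theta 6 (of_int c / 6) * theta 30 (of_int c / 6)"
      using infsetsum_product[OF _ _ gauss_summable(2)[of 6 "of_int c / 6"] gauss_summable(2)[of 30 "of_int c / 6"]]
      by (simp add: k_def theta_def)
    moreover have "infsetsum (\<lambda>p. h (g c p)) UNIV = infsetsum (\<lambda>p. \<omega> powi c * of_real (k p)) UNIV"
      by (rule infsetsum_cong) (auto simp: hg k_def)
    moreover have "\<dots> = \<omega> powi c * of_real (infsetsum k UNIV)"
      using ks by (subst infsetsum_cmult_right) (auto simp: infsetsum_of_real)
    ultimately show "infsetsum (\<lambda>p. h (g c p)) UNIV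
        = \<omega> powi c * of_real (theta 6 (of_int c / 6) * theta 30 (of_int c / 6))"
      by simp
  qed
  also have "{0..<6::int} = {0,1,2,3,4,5}" by auto
  \<comment> \<open>The class \<open>c = 3\<close> vanishes by \<open>theta_half\<close>. Classes
    \<open>c\<close> and \<open>6 - c\<close> have equal theta products because the two signs
    cancel, and their powers of \<open>\<omega>\<close> add up to -1.\<close>
  also have "(\<Sum>c\<in>{0,1,2,3,4,5::int}. \<omega> powi c * of_real (theta 6 (of_int c / 6) * theta 30 (of_int c / 6)))
      = of_real (theta 6 0 * theta 30 0) + (\<omega> + \<omega>\<^sup>2 * \<omega> ^ 3) * of_real (theta 6 (1/6) * theta 30 (1/6))
        + (\<omega>\<^sup>2 + \<omega> * \<omega> ^ 3) * of_real (theta 6 (1/3) * theta 30 (1/3))"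
  proof -
    have t: "theta \<kappa> (2/3) = - theta \<kappa> (1/3)" "theta \<kappa> (5/6) = - theta \<kappa> (1/6)" for \<kappa>
      using theta_one_minus[of \<kappa> "1/3"] theta_one_minus[of \<kappa> "1/6"] by simp_all
    have "\<omega> powi 4 = \<omega> * \<omega> ^ 3" "\<omega> powi 5 = \<omega>\<^sup>2 * \<omega> ^ 3"
      by (simp_all add: power_add[symmetric] flip: power_Suc)
    thus ?thesis by (simp add: t theta_half algebra_simps)
  qed
  also have "\<dots> = of_real (theta 6 0 * theta 30 0) - of_real (theta 6 (1/6) * theta 30 (1/6))
        - of_real (theta 6 (1/3) * theta 30 (1/3))"
  proof -
    have "\<omega> + \<omega>\<^sup>2 = -1" "\<omega>\<^sup>2 + \<omega> = -1" using w2 by (simp_all add: eq_neg_iff_add_eq_0 add_ac)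
    thus ?thesis by (simp add: w3)
  qed
  finally show ?thesis by simp
qed

end

text \<open>Neither evaluation of the double series involves \<open>\<omega>\<close>, so a concrete
  primitive cube root turns the comparison into an equation of reals.\<close>

lemma twisted_theta_identity:
  "theta 6 0 * theta 30 0 - theta 6 (1/6) * theta 30 (1/6) - theta 6 (1/3) * theta 30 (1/3)
     = prog 2 2 * (prog 12 6 * prog 2 1 / (prog 6 3 * prog 4 2)) * (prog 10 10 * (prog 30 15 / prog 10 5))"
proof -
  define \<omega> where "\<omega> = Complex (- 1 / 2) (sqrt 3 / 2)"
  have w: "\<omega>\<^sup>2 + \<omega> + 1 = 0"
    by (simp add: \<omega>_def power2_eq_square complex_eq_iff field_simps)
  have "complex_of_real (theta 6 0 * theta 30 0 - theta 6 (1/6) * theta 30 (1/6) - theta 6 (1/3) * theta 30 (1/3))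
     = of_real (prog 2 2 * (prog 12 6 * prog 2 1 / (prog 6 3 * prog 4 2)) * (prog 10 10 * (prog 30 15 / prog 10 5)))"
    unfolding twist_mult[OF w, symmetric] twist1_product[OF w] twist2_product[OF w] of_real_mult ..
  thus ?thesis by (simp only: of_real_eq_iff)
qed

end

section \<open>Theta relations modulo 60\<close>

context nome
begin

text \<open>The bracket \<open>[a]\<close> of the overview, except at \<open>a = 30\<close>: there
  the two classes coincide and \<open>br 30\<close> is the square of
  \<open>prog 60 30\<close>.\<close>

definition br :: "nat \<Rightarrow> real" where
  "br a = prog 60 a * prog 60 (60 - a)"

lemma br_nonzero: "0 < a \<Longrightarrow> a < 60 \<Longrightarrow> br a \<noteq> 0"
  by (simp add: br_def prog_nonzero)

lemma theta60_br:
  assumes "0 < a" "a < 60"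
  shows "theta60 (real a) = q powr ((30 - real a)\<^sup>2 / 120) * (prog 60 60 * br a)"
proof -
  have "30 * (real a / 60 - 1 / 2)\<^sup>2 = (30 - real a)\<^sup>2 / 120"
    by (simp add: power2_eq_square field_simps)
  moreover have "theta60 (real a) = q powr (30 * (real a / 60 - 1 / 2)\<^sup>2) * (prog 60 60 * br a)"
    using theta_product[OF assms] by (simp add: theta60_def br_def)
  ultimately show ?thesis by (simp only:)
qed

lemma theta60_br4:
  assumes "{a, b, c, d} \<subseteq> {0<..<60}"
  shows "theta60 (real a) * theta60 (real b) * (theta60 (real c) * theta60 (real d))
    = q powr (((30 - real a)\<^sup>2 + (30 - real b)\<^sup>2 + (30 - real c)\<^sup>2 + (30 - real d)\<^sup>2) / 120)
        * (prog 60 60 ^ 4 * (br a * br b * br c * br d))"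
  using assms by (simp add: theta60_br add_divide_distrib powr_add power4_eq_xxxx mult_ac)

text \<open>All three products contain four theta factors, so \<open>prog 60 60 ^ 4\<close> cancels.
  The sums of squares differ by multiples of 120, which leaves the integral powers
  \<open>q ^ m\<close> and \<open>q ^ n\<close>.\<close>

lemma three_term_br:
  fixes s t :: real and a1 a2 a3 a4 b1 b2 b3 b4 c1 c2 c3 c4 m n :: nat
  assumes "theta60 (real a1) * theta60 (real a2) * (theta60 (real a3) * theta60 (real a4))
      = s * (theta60 (real b1) * theta60 (real b2) * (theta60 (real b3) * theta60 (real b4)))
      + t * (theta60 (real c1) * theta60 (real c2) * (theta60 (real c3) * theta60 (real c4)))"
    and "{a1, a2, a3, a4} \<subseteq> {0<..<60}" "{b1, b2, b3, b4} \<subseteq> {0<..<60}" "{c1, c2, c3, c4} \<subseteq> {0<..<60}"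
    and eb: "(30 - real b1)\<^sup>2 + (30 - real b2)\<^sup>2 + (30 - real b3)\<^sup>2 + (30 - real b4)\<^sup>2
      = (30 - real a1)\<^sup>2 + (30 - real a2)\<^sup>2 + (30 - real a3)\<^sup>2 + (30 - real a4)\<^sup>2 + 120 * real m"
    and ec: "(30 - real c1)\<^sup>2 + (30 - real c2)\<^sup>2 + (30 - real c3)\<^sup>2 + (30 - real c4)\<^sup>2
      = (30 - real a1)\<^sup>2 + (30 - real a2)\<^sup>2 + (30 - real a3)\<^sup>2 + (30 - real a4)\<^sup>2 + 120 * real n"
  shows "br a1 * br a2 * br a3 * br a4
      = s * q ^ m * (br b1 * br b2 * br b3 * br b4) + t * q ^ n * (br c1 * br c2 * br c3 * br c4)"
proof -
  define e where "e = q powr (((30 - real a1)\<^sup>2 + (30 - real a2)\<^sup>2 + (30 - real a3)\<^sup>2 + (30 - real a4)\<^sup>2) / 120)"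
  define K where "K = e * prog 60 60 ^ 4"
  have "K \<noteq> 0" using q_pos by (simp add: K_def e_def prog_nonzero)
  have sh: "q powr ((x + 120 * real k) / 120) = q powr (x / 120) * q ^ k" for x k
    using q_pos by (simp add: add_divide_distrib powr_add powr_realpow)
  have "K * (br a1 * br a2 * br a3 * br a4)
      = K * (s * q ^ m * (br b1 * br b2 * br b3 * br b4) + t * q ^ n * (br c1 * br c2 * br c3 * br c4))"
    using assms(1) unfolding theta60_br4[OF assms(2)] theta60_br4[OF assms(3)] theta60_br4[OF assms(4)] eb ec sh e_def[symmetric] K_def
    by (simp add: algebra_simps)
  with \<open>K \<noteq> 0\<close> show ?thesis by simp
qed

text \<open>Together with \<open>br_rel_1\<close>, \<open>br_rel_13\<close> and
  \<open>br_rel_7\<close> this replaces a pair of brackets coprime to 30 by even ones; the choice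
  \<open>y = 15\<close> produces a pair with sum 30. Up to signs and powers of \<open>q\<close> the
  four are images of each other under the multipliers of the overview.\<close>

lemma br_rel_11:
  "br 11 * br 19 * br 18 * br 30 = br 9 * br 21 * br 20 * br 28 + q ^ 9 * (br 9 * br 21 * br 2 * br 10)"
proof -
  have "theta60 11 * theta60 19 * (theta60 18 * theta60 30) = 1 * (theta60 9 * theta60 21 * (theta60 20 * theta60 28)) + (1) * (theta60 9 * theta60 21 * (theta60 2 * theta60 10))"
    using weierstrass_three_term[of "-4" "15" "-24" "6"] theta60_reflect[of 39]
    by (simp add: theta60_uminus mult_ac)
  thus ?thesis
    using three_term_br[where s = "1" and t = "1" and m = 0 and n = 9 and ?a1.0 = 11 and ?a2.0 = 19 and ?a3.0 = 18 and ?a4.0 = 30 and ?b1.0 = 9 and ?b2.0 = 21 and ?b3.0 = 20 and ?b4.0 = 28 and ?c1.0 = 9 and ?c2.0 = 21 and ?c3.0 = 2 and ?c4.0 = 10]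
    by simp
qed

lemma br_rel_1:
  "br 1 * br 29 * br 18 * br 30 = br 9 * br 21 * br 10 * br 22 - q * (br 9 * br 21 * br 8 * br 20)"
proof -
  have "theta60 1 * theta60 29 * (theta60 18 * theta60 30) = 1 * (theta60 9 * theta60 21 * (theta60 10 * theta60 22)) + (-1) * (theta60 9 * theta60 21 * (theta60 8 * theta60 20))"
    using weierstrass_three_term[of "-14" "15" "-24" "6"] theta60_reflect[of 38] theta60_reflect[of 39]
    by (simp add: theta60_uminus mult_ac)
  thus ?thesis
    using three_term_br[where s = "1" and t = "-1" and m = 0 and n = 1 and ?a1.0 = 1 and ?a2.0 = 29 and ?a3.0 = 18 and ?a4.0 = 30 and ?b1.0 = 9 and ?b2.0 = 21 and ?b3.0 = 10 and ?b4.0 = 22 and ?c1.0 = 9 and ?c2.0 = 21 and ?c3.0 = 8 and ?c4.0 = 20]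
    by simp
qed

lemma br_rel_13:
  "br 13 * br 17 * br 6 * br 30 = br 3 * br 27 * br 16 * br 20 + q ^ 3 * (br 3 * br 27 * br 10 * br 14)"
proof -
  have "theta60 13 * theta60 17 * (theta60 6 * theta60 30) = 1 * (theta60 3 * theta60 27 * (theta60 16 * theta60 20)) + (1) * (theta60 3 * theta60 27 * (theta60 10 * theta60 14))"
    using weierstrass_three_term[of "-2" "15" "-12" "18"] theta60_reflect[of 33]
    by (simp add: theta60_uminus mult_ac)
  thus ?thesis
    using three_term_br[where s = "1" and t = "1" and m = 0 and n = 3 and ?a1.0 = 13 and ?a2.0 = 17 and ?a3.0 = 6 and ?a4.0 = 30 and ?b1.0 = 3 and ?b2.0 = 27 and ?b3.0 = 16 and ?b4.0 = 20 and ?c1.0 = 3 and ?c2.0 = 27 and ?c3.0 = 10 and ?c4.0 = 14]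
    by simp
qed

lemma br_rel_7:
  "br 7 * br 23 * br 6 * br 30 = br 3 * br 27 * br 10 * br 26 + q ^ 3 * (br 3 * br 27 * br 4 * br 20)"
proof -
  have "theta60 7 * theta60 23 * (theta60 6 * theta60 30) = 1 * (theta60 3 * theta60 27 * (theta60 10 * theta60 26)) + (1) * (theta60 3 * theta60 27 * (theta60 4 * theta60 20))"
    using weierstrass_three_term[of "-8" "15" "-12" "18"] theta60_reflect[of 33]
    by (simp add: theta60_uminus mult_ac)
  thus ?thesis
    using three_term_br[where s = "1" and t = "1" and m = 0 and n = 3 and ?a1.0 = 7 and ?a2.0 = 23 and ?a3.0 = 6 and ?a4.0 = 30 and ?b1.0 = 3 and ?b2.0 = 27 and ?b3.0 = 10 and ?b4.0 = 26 and ?c1.0 = 3 and ?c2.0 = 27 and ?c3.0 = 4 and ?c4.0 = 20]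
    by simp
qed

text \<open>This and the next three relations involve only even brackets. The choice
  \<open>u = -24\<close>, \<open>v = 6\<close> produces the factors 18 and 30, and with 6 they form
  the product called \<open>V\<close> in the elimination lemmas.\<close>

lemma br_rel_14:
  "br 6 * br 18 * br 30 * br 14 = br 4 * br 16 * br 20 * br 28 + q ^ 4 * (br 2 * br 10 * br 14 * br 26)"
proof -
  have "theta60 6 * theta60 18 * (theta60 30 * theta60 14) = 1 * (theta60 4 * theta60 16 * (theta60 20 * theta60 28)) + (1) * (theta60 2 * theta60 10 * (theta60 14 * theta60 26))"
    using weierstrass_three_term[of "10" "4" "-24" "6"] theta60_reflect[of 34]
    by (simp add: theta60_uminus mult_ac)
  thus ?thesis
    using three_term_br[where s = "1" and t = "1" and m = 0 and n = 4 and ?a1.0 = 6 and ?a2.0 = 18 and ?a3.0 = 30 and ?a4.0 = 14 and ?b1.0 = 4 and ?b2.0 = 16 and ?b3.0 = 20 and ?b4.0 = 28 and ?c1.0 = 2 and ?c2.0 = 10 and ?c3.0 = 14 and ?c4.0 = 26]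
    by simp
qed

lemma br_rel_22:
  "br 6 * br 18 * br 30 * br 22 = br 8 * br 16 * br 20 * br 28 - q ^ 6 * (br 2 * br 10 * br 14 * br 22)"
proof -
  have "theta60 6 * theta60 18 * (theta60 30 * theta60 22) = 1 * (theta60 8 * theta60 16 * (theta60 20 * theta60 28)) + (-1) * (theta60 2 * theta60 10 * (theta60 14 * theta60 22))"
    using weierstrass_three_term[of "14" "8" "-24" "6"] theta60_reflect[of 32] theta60_reflect[of 38]
    by (simp add: theta60_uminus mult_ac)
  thus ?thesis
    using three_term_br[where s = "1" and t = "-1" and m = 0 and n = 6 and ?a1.0 = 6 and ?a2.0 = 18 and ?a3.0 = 30 and ?a4.0 = 22 and ?b1.0 = 8 and ?b2.0 = 16 and ?b3.0 = 20 and ?b4.0 = 28 and ?c1.0 = 2 and ?c2.0 = 10 and ?c3.0 = 14 and ?c4.0 = 22]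
    by simp
qed

lemma br_rel_2:
  "br 4 * br 8 * br 20 * br 28 = br 2 * br 10 * br 22 * br 26 + q ^ 2 * (br 6 * br 18 * br 30 * br 2)"
proof -
  have "theta60 4 * theta60 8 * (theta60 20 * theta60 28) = 1 * (theta60 2 * theta60 10 * (theta60 22 * theta60 26)) + (1) * (theta60 6 * theta60 18 * (theta60 30 * theta60 2))"
    using weierstrass_three_term[of "-2" "4" "-24" "6"] 
    by (simp add: theta60_uminus mult_ac)
  thus ?thesis
    using three_term_br[where s = "1" and t = "1" and m = 0 and n = 2 and ?a1.0 = 4 and ?a2.0 = 8 and ?a3.0 = 20 and ?a4.0 = 28 and ?b1.0 = 2 and ?b2.0 = 10 and ?b3.0 = 22 and ?b4.0 = 26 and ?c1.0 = 6 and ?c2.0 = 18 and ?c3.0 = 30 and ?c4.0 = 2]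
    by simp
qed

lemma br_rel_26:
  "br 6 * br 18 * br 30 * br 26 = br 10 * br 14 * br 22 * br 26 - q ^ 6 * (br 4 * br 8 * br 16 * br 20)"
proof -
  have "theta60 6 * theta60 18 * (theta60 30 * theta60 26) = 1 * (theta60 10 * theta60 14 * (theta60 22 * theta60 26)) + (-1) * (theta60 4 * theta60 8 * (theta60 16 * theta60 20))"
    using weierstrass_three_term[of "10" "16" "-24" "6"] theta60_reflect[of 34] theta60_reflect[of 40]
    by (simp add: theta60_uminus mult_ac)
  thus ?thesis
    using three_term_br[where s = "1" and t = "-1" and m = 0 and n = 6 and ?a1.0 = 6 and ?a2.0 = 18 and ?a3.0 = 30 and ?a4.0 = 26 and ?b1.0 = 10 and ?b2.0 = 14 and ?b3.0 = 22 and ?b4.0 = 26 and ?c1.0 = 4 and ?c2.0 = 8 and ?c3.0 = 16 and ?c4.0 = 20]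
    by simp
qed
text \<open>The product \<open>E\<close> of the overview. Its set of classes modulo 60 is stable
  under multiplication by 7, 11 and 17, so the same factor serves all four identities.\<close>

definition core_prod :: real where
  "core_prod = br 1 * br 7 * br 11 * br 13 * br 17 * br 19 * br 23 * br 29 * br 10 * br 20"

text \<open>This is \<open>twisted_theta_identity\<close> in bracket form: both sides are resolved
  into progressions modulo 60 and the common factor \<open>prog 12 12 * prog 60 60\<close> is
  cancelled.\<close>

lemma level_12_relation:
  "(br 6 * br 18 * br 30)\<^sup>2 - q * (br 4 * br 8 * br 16 * br 20 * br 28) * br 20
      - q ^ 4 * (br 2 * br 10 * br 14 * br 22 * br 26) * br 10
    = (br 4 * br 8 * br 16 * br 20 * br 28) * (br 6 * br 18 * br 30) * core_prod"
proof -
  define p where "p = prog 60"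
  have split5: "prog 12 r = p r * p (12 + r) * p (24 + r) * p (36 + r) * p (48 + r)" if "r > 0" for r
    using prog_split[of 12 r 5] that by (simp add: p_def eval_nat_numeral lessThan_Suc mult_ac)
  have nz: "p r \<noteq> 0" if "r > 0" for r using that by (simp add: p_def prog_nonzero)
  have nz12: "prog 12 12 \<noteq> 0" by (simp add: prog_nonzero)
  have t0: "theta 6 0 = prog 12 12 * (prog 12 6 * prog 12 6)"
    using theta_product[of 6 12] q_pos by simp
  have t0': "theta 30 0 = p 60 * (p 30 * p 30)"
    using theta_product[of 30 60] q_pos by (simp add: p_def)
  \<comment> \<open>The shifts 0, 1/6 and 1/3 correspond to \<open>a\<close> = 6, 8, 10 modulo 12
    and to \<open>a\<close> = 30, 40, 50 modulo 60. The fractional powers combine to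
    \<open>q\<close> and \<open>q ^ 4\<close>.\<close>
  have t1: "theta 6 (1/6) = q powr (1/6) * (prog 12 12 * (prog 12 8 * prog 12 4))"
    using theta_product[of 8 12] by (simp add: power2_eq_square)
  have t1': "theta 30 (1/6) = q powr (5/6) * (p 60 * (p 40 * p 20))"
    using theta_product[of 40 60] by (simp add: power2_eq_square p_def)
  have t2: "theta 6 (1/3) = q powr (2/3) * (prog 12 12 * (prog 12 10 * prog 12 2))"
    using theta_product[of 10 12] by (simp add: power2_eq_square)
  have t2': "theta 30 (1/3) = q powr (10/3) * (p 60 * (p 50 * p 10))"
    using theta_product[of 50 60] by (simp add: power2_eq_square p_def)
  have pw: "q powr (1/6) * q powr (5/6) = q" "q powr (2/3) * q powr (10/3) = q ^ 4"
    using q_pos by (simp_all add: powr_add[symmetric] powr_numeral)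
  have L: "theta 6 0 * theta 30 0 - theta 6 (1/6) * theta 30 (1/6) - theta 6 (1/3) * theta 30 (1/3)
     = prog 12 12 * p 60 * ((prog 12 6 * prog 12 6) * (p 30 * p 30) - q * (prog 12 8 * prog 12 4) * (p 40 * p 20)
        - q ^ 4 * (prog 12 10 * prog 12 2) * (p 50 * p 10))"
    unfolding t0 t0' t1 t1' t2 t2' pw(2)[symmetric] by (subst (3) pw(1)[symmetric]) (simp add: algebra_simps)
  have s2: "prog 2 2 = prog 4 2 * prog 4 4"
    using prog_split[of 2 2 2] by (simp add: eval_nat_numeral lessThan_Suc mult_ac)
  have s4: "prog 4 4 = prog 12 4 * prog 12 8 * prog 12 12"
    using prog_split[of 4 4 3] by (simp add: eval_nat_numeral lessThan_Suc mult_ac)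
  have s10: "prog 10 10 = p 10 * p 20 * p 30 * p 40 * p 50 * p 60"
    using prog_split[of 10 10 6] by (simp add: p_def eval_nat_numeral lessThan_Suc mult_ac)
  define D where "D = br 1 * br 7 * br 11 * br 13 * br 17 * br 19 * br 23 * br 29"
  \<comment> \<open>Inclusion-exclusion for the odd integers: removing multiples of 3 and of 5 and
    restoring those of 15 leaves the integers coprime to 30, whose product is
    \<open>D\<close>.\<close>
  have odd: "prog 2 1 * prog 30 15 = prog 6 3 * prog 10 5 * D"
    using prog_split[of 2 1 30] prog_split[of 30 15 2] prog_split[of 6 3 10] prog_split[of 10 5 6]
    by (simp add: D_def br_def lessThan_nat_numeral lessThan_Suc mult_ac)
  have V: "br 6 * br 18 * br 30 = prog 12 6 * p 30"
    by (simp add: split5 br_def p_def mult_ac)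
  have T4: "br 4 * br 8 * br 16 * br 20 * br 28 = prog 12 8 * prog 12 4"
    by (simp add: split5 br_def p_def mult_ac)
  have T2: "br 2 * br 10 * br 14 * br 22 * br 26 = prog 12 10 * prog 12 2"
    by (simp add: split5 br_def p_def mult_ac)
  have b: "br 20 = p 40 * p 20" "br 10 = p 50 * p 10"
    by (simp_all add: br_def p_def mult_ac)
  have E: "core_prod = D * br 10 * br 20"
    by (simp only: core_prod_def D_def)
  have "prog 2 2 * (prog 12 6 * prog 2 1 / (prog 6 3 * prog 4 2)) * (prog 10 10 * (prog 30 15 / prog 10 5))
      = prog 4 4 * prog 12 6 * prog 10 10 * (prog 2 1 * prog 30 15) / (prog 6 3 * prog 10 5)"
    unfolding s2 using prog_nonzero[of 4 2] by (simp add: field_simps)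
  also have "\<dots> = prog 4 4 * prog 12 6 * prog 10 10 * D"
    unfolding odd using prog_nonzero[of 6 3] prog_nonzero[of 10 5] by (simp add: field_simps)
  also have "\<dots> = prog 12 12 * p 60 * ((prog 12 8 * prog 12 4) * (prog 12 6 * p 30) * (D * (p 50 * p 10) * (p 40 * p 20)))"
    unfolding s4 s10 by (simp only: mult_ac)
  finally have "prog 12 12 * p 60 * ((prog 12 6 * prog 12 6) * (p 30 * p 30) - q * (prog 12 8 * prog 12 4) * (p 40 * p 20)
        - q ^ 4 * (prog 12 10 * prog 12 2) * (p 50 * p 10))
      = prog 12 12 * p 60 * ((prog 12 8 * prog 12 4) * (prog 12 6 * p 30) * (D * (p 50 * p 10) * (p 40 * p 20)))"
    using twisted_theta_identity unfolding L by simp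
  hence "(prog 12 6 * prog 12 6) * (p 30 * p 30) - q * (prog 12 8 * prog 12 4) * (p 40 * p 20)
        - q ^ 4 * (prog 12 10 * prog 12 2) * (p 50 * p 10)
      = (prog 12 8 * prog 12 4) * (prog 12 6 * p 30) * (D * (p 50 * p 10) * (p 40 * p 20))"
    using nz12 nz[of 60] by simp
  thus ?thesis
    unfolding V T4 T2 E unfolding b by (simp add: power2_eq_square mult_ac)
qed

end

section \<open>Elimination of the auxiliary brackets\<close>

text \<open>
  The number \<open>k\<close> in the names \<open>elimination_k\<close> and \<open>identity_k\<close> is the multiplier that carries the identity
  for \<open>k = 1\<close> to the given one.
\<close>

lemma elimination_1:
  fixes q V E b2 b4 b8 b10 b14 b16 b20 b22 b26 b28 :: real
  assumes fin: "V\<^sup>2 - q * (b4 * b8 * b16 * b20 * b28) * b20 - q ^ 4 * (b2 * b10 * b14 * b22 * b26) * b10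
      = (b4 * b8 * b16 * b20 * b28) * V * E"
    and v14: "V * b14 = b4 * b16 * b20 * b28 + q ^ 4 * (b2 * b10 * b14 * b26)"
    and v26: "V * b26 = b10 * b14 * b22 * b26 - q ^ 6 * (b4 * b8 * b16 * b20)"
    and nz: "b4 * b8 * b16 * b20 * b28 \<noteq> 0"
  shows "V * b28 - q * b8 * b14 * (b20 * b28 + q ^ 9 * (b2 * b10)) = E * V * b8 * b14 * b28"
proof -
  \<comment> \<open>An explicit certificate: the desired difference, times a nonzero product, is a
    polynomial combination of the three hypotheses.\<close>
  have "(b4 * b8 * b16 * b20 * b28) * (V * b28 - q * b8 * b14 * (b20 * b28 + q ^ 9 * (b2 * b10)) - E * V * b8 * b14 * b28)
     = b8 * b14 * b28 * ((V\<^sup>2 - q * (b4 * b8 * b16 * b20 * b28) * b20 - q ^ 4 * (b2 * b10 * b14 * b22 * b26) * b10)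
          - (b4 * b8 * b16 * b20 * b28) * V * E)
       - b8 * b28 * V * (V * b14 - (b4 * b16 * b20 * b28 + q ^ 4 * (b2 * b10 * b14 * b26)))
       - q ^ 4 * b8 * b28 * b2 * b10 * b14 * (V * b26 - (b10 * b14 * b22 * b26 - q ^ 6 * (b4 * b8 * b16 * b20)))"
    by algebra
  also have "\<dots> = 0" unfolding fin v14 v26 by simp
  finally show ?thesis using nz by simp
qed

text \<open>Multiplication by 7 sends the brackets 14 and 26 to 22 and 2, so these are the auxiliary
  relations that replace the ones for the multiplier 1.\<close>

lemma elimination_7:
  fixes q V E b2 b4 b8 b10 b14 b16 b20 b22 b26 b28 :: real
  assumes fin: "V\<^sup>2 - q * (b4 * b8 * b16 * b20 * b28) * b20 - q ^ 4 * (b2 * b10 * b14 * b22 * b26) * b10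
      = (b4 * b8 * b16 * b20 * b28) * V * E"
    and v22: "V * b22 = b8 * b16 * b20 * b28 - q ^ 6 * (b2 * b10 * b14 * b22)"
    and v2: "b4 * b8 * b20 * b28 = b2 * b10 * b22 * b26 + q ^ 2 * (V * b2)"
    and nz: "b4 * b8 * b16 * b20 * b28 \<noteq> 0"
  shows "V * b16 - q * b4 * b22 * (b16 * b20 + q ^ 3 * (b10 * b14)) = E * V * b4 * b22 * b16"
proof -
  have "(b4 * b8 * b16 * b20 * b28) * (V * b16 - q * b4 * b22 * (b16 * b20 + q ^ 3 * (b10 * b14)) - E * V * b4 * b22 * b16)
     = b4 * b22 * b16 * ((V\<^sup>2 - q * (b4 * b8 * b16 * b20 * b28) * b20 - q ^ 4 * (b2 * b10 * b14 * b22 * b26) * b10)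
          - (b4 * b8 * b16 * b20 * b28) * V * E)
       - b4 * b16 * V * (V * b22 - (b8 * b16 * b20 * b28 - q ^ 6 * (b2 * b10 * b14 * b22)))
       - q ^ 4 * b4 * b16 * b22 * b10 * b14 * (b4 * b8 * b20 * b28 - (b2 * b10 * b22 * b26 + q ^ 2 * (V * b2)))"
    by algebra
  also have "\<dots> = 0" unfolding fin v22 v2[symmetric] by simp
  finally show ?thesis using nz by simp
qed

lemma elimination_11:
  fixes q V E b2 b4 b8 b10 b14 b16 b20 b22 b26 b28 :: real
  assumes fin: "V\<^sup>2 - q * (b4 * b8 * b16 * b20 * b28) * b20 - q ^ 4 * (b2 * b10 * b14 * b22 * b26) * b10
      = (b4 * b8 * b16 * b20 * b28) * V * E"
    and v14: "V * b14 = b4 * b16 * b20 * b28 + q ^ 4 * (b2 * b10 * b14 * b26)"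
    and v26: "V * b26 = b10 * b14 * b22 * b26 - q ^ 6 * (b4 * b8 * b16 * b20)"
    and nz: "b4 * b8 * b16 * b20 * b28 \<noteq> 0"
  shows "(b10 * b22 - q * (b8 * b20)) * b26 * b28 - q ^ 6 * V * b8 = E * V * b8 * b26 * b28"
proof -
  have "(b4 * b8 * b16 * b20 * b28) * ((b10 * b22 - q * (b8 * b20)) * b26 * b28 - q ^ 6 * V * b8 - E * V * b8 * b26 * b28)
     = b8 * b26 * b28 * ((V\<^sup>2 - q * (b4 * b8 * b16 * b20 * b28) * b20 - q ^ 4 * (b2 * b10 * b14 * b22 * b26) * b10)
          - (b4 * b8 * b16 * b20 * b28) * V * E)
       - b8 * b28 * V * (V * b26 - (b10 * b14 * b22 * b26 - q ^ 6 * (b4 * b8 * b16 * b20)))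
       - b8 * b28 * b10 * b22 * b26 * (V * b14 - (b4 * b16 * b20 * b28 + q ^ 4 * (b2 * b10 * b14 * b26)))"
    by algebra
  also have "\<dots> = 0" unfolding fin v14 v26 by simp
  finally show ?thesis using nz by simp
qed

text \<open>Multiplication by 17 exchanges the roles of the relations for 2 and 22 compared with the
  multiplier 7. The level 12 relation now enters with weight \<open>q ^ 2\<close>, hence this factor
  before \<open>E\<close>.\<close>

lemma elimination_17:
  fixes q V E b2 b4 b8 b10 b14 b16 b20 b22 b26 b28 :: real
  assumes fin: "V\<^sup>2 - q * (b4 * b8 * b16 * b20 * b28) * b20 - q ^ 4 * (b2 * b10 * b14 * b22 * b26) * b10
      = (b4 * b8 * b16 * b20 * b28) * V * E"
    and v22: "V * b22 = b8 * b16 * b20 * b28 - q ^ 6 * (b2 * b10 * b14 * b22)"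
    and v2: "b4 * b8 * b20 * b28 = b2 * b10 * b22 * b26 + q ^ 2 * (V * b2)"
    and nz: "b4 * b8 * b16 * b20 * b28 \<noteq> 0"
  shows "V * b4 - b2 * b16 * (b10 * b26 + q ^ 3 * (b4 * b20)) = q ^ 2 * E * V * b2 * b16 * b4"
proof -
  have "(b4 * b8 * b16 * b20 * b28) * (V * b4 - b2 * b16 * (b10 * b26 + q ^ 3 * (b4 * b20)) - q ^ 2 * E * V * b2 * b16 * b4)
     = q ^ 2 * b2 * b4 * b16 * ((V\<^sup>2 - q * (b4 * b8 * b16 * b20 * b28) * b20 - q ^ 4 * (b2 * b10 * b14 * b22 * b26) * b10)
          - (b4 * b8 * b16 * b20 * b28) * V * E)
       + b4 * b16 * V * (b4 * b8 * b20 * b28 - (b2 * b10 * b22 * b26 + q ^ 2 * (V * b2)))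
       + b4 * b16 * b2 * b10 * b26 * (V * b22 - (b8 * b16 * b20 * b28 - q ^ 6 * (b2 * b10 * b14 * b22)))"
    by algebra
  also have "\<dots> = 0" unfolding fin v22 v2[symmetric] by simp
  finally show ?thesis using nz by simp
qed

section \<open>Generating functions of partitions\<close>

text \<open>A partition either avoids \<open>s\<close> or arises from a smaller one by adding one
  copy of \<open>s\<close>.\<close>

lemma num_partitions_insert:
  assumes s: "s \<notin> S" "s > 0" and S: "0 \<notin> S"
  shows "num_partitions (insert s S) n
    = num_partitions S n + (if s \<le> n then num_partitions (insert s S) (n - s) else 0)"
proof -
  define A where "A = (\<lambda>S n. {P :: nat multiset. set_mset P \<subseteq> S \<and> sum_mset P = n})"
  have fin: "finite (A (insert s S) k)" for k
    unfolding A_def using s S by (intro finite_partitions) auto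
  have split: "A (insert s S) n = A S n \<union> {P \<in> A (insert s S) n. s \<in># P}"
    using s(1) by (auto simp: A_def)
  have disj: "A S n \<inter> {P \<in> A (insert s S) n. s \<in># P} = {}"
    using s(1) by (auto simp: A_def)
  have "card (A (insert s S) n) = card (A S n) + card {P \<in> A (insert s S) n. s \<in># P}"
    using fin[of n] by (subst split, intro card_Un_disjoint disj) (auto simp: A_def intro: finite_subset[OF _ fin[of n, unfolded A_def]])
  also have "card {P \<in> A (insert s S) n. s \<in># P} = (if s \<le> n then card (A (insert s S) (n - s)) else 0)"
  proof (cases "s \<le> n")
    case True
    have "bij_betw (add_mset s) (A (insert s S) (n - s)) {P \<in> A (insert s S) n. s \<in># P}"
    proof (rule bij_betwI[where g = "\<lambda>P. P - {#s#}"])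
      show "(\<lambda>P. P - {#s#}) \<in> {P \<in> A (insert s S) n. s \<in># P} \<rightarrow> A (insert s S) (n - s)"
        by (auto simp: A_def sum_mset_diff dest: in_diffD)
    qed (use True in \<open>auto simp: A_def\<close>)
    thus ?thesis using True by (simp add: bij_betw_same_card)
  next
    case False
    hence "{P \<in> A (insert s S) n. s \<in># P} = {}"
      by (auto simp: A_def dest!: multi_member_split)
    thus ?thesis using False by (simp only: card.empty if_False)
  qed
  finally show ?thesis by (simp only: A_def num_partitions_def)
qed

lemma num_partitions_empty: "num_partitions {} n = (if n = 0 then 1 else 0)"
proof -
  have "{P :: nat multiset. set_mset P \<subseteq> {} \<and> sum_mset P = n} = (if n = 0 then {{#}} else {})"
    by auto
  thus ?thesis by (simp add: num_partitions_def)
qed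

text \<open>For a new part \<open>s\<close> the recurrence makes the sum satisfy
  \<open>A = B + x ^ s * A\<close>. Solving this requires convergence, which is obtained
  first.\<close>

lemma finite_partition_sums:
  fixes x :: real
  assumes x: "0 < x" "x < 1" and S: "finite S" "0 \<notin> S"
  shows "(\<lambda>n. real (num_partitions S n) * x ^ n) sums (\<Prod>s\<in>S. 1 / (1 - x ^ s))"
  using S
proof (induction S rule: finite_induct)
  case empty
  have "(\<lambda>n. real (num_partitions {} n) * x ^ n) = (\<lambda>n. if n = 0 then 1 else 0)"
    by (auto simp: num_partitions_empty)
  thus ?case using sums_If_finite[of "\<lambda>n. n = 0" "\<lambda>_. 1::real"] by simp
next
  case (insert s S)
  define a where "a = (\<lambda>n. real (num_partitions (insert s S) n) * x ^ n)"
  define b where "b = (\<lambda>n. real (num_partitions S n) * x ^ n)"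
  define B where "B = (\<Prod>s\<in>S. 1 / (1 - x ^ s))"
  have s: "s > 0" "s \<notin> S" "0 \<notin> S" using insert by auto
  have bs: "b sums B" unfolding b_def B_def using insert s by auto
  have xs: "x ^ s < 1" using x s by (simp add: power_less_one_iff)
  have rec: "a n = b n + (if s \<le> n then x ^ s * a (n - s) else 0)" for n
  proof (cases "s \<le> n")
    case True
    hence "x ^ n = x ^ s * x ^ (n - s)" by (simp add: power_add[symmetric])
    thus ?thesis using True
      unfolding a_def b_def num_partitions_insert[OF s(2,1,3), of n] by (simp add: algebra_simps)
  qed (unfold a_def b_def num_partitions_insert[OF s(2,1,3), of n], simp)
  have a0: "a n \<ge> 0" for n using x by (simp add: a_def)
  have b0: "b n \<ge> 0" for n using x by (simp add: b_def)
  have shift: "(\<Sum>n<N. if s \<le> n then x ^ s * a (n - s) else 0) = x ^ s * (\<Sum>n<N - s. a n)" for N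
  proof -
    have "(\<Sum>n<N. if s \<le> n then x ^ s * a (n - s) else 0) = (\<Sum>n\<in>{s..<N}. x ^ s * a (n - s))"
      by (rule sum.mono_neutral_cong_right) auto
    also have "\<dots> = (\<Sum>n<N - s. x ^ s * a n)"
      by (rule sum.reindex_bij_witness[where i = "\<lambda>n. n + s" and j = "\<lambda>n. n - s"]) auto
    finally show ?thesis by (simp add: sum_distrib_left)
  qed
  \<comment> \<open>The recurrence bounds a partial sum by \<open>B\<close> plus
    \<open>x ^ s\<close> times itself; as the terms are nonnegative, boundedness gives
    summability.\<close>
  have bound: "(\<Sum>n<N. a n) \<le> B / (1 - x ^ s)" for N
  proof -
    have "(\<Sum>n<N. a n) = (\<Sum>n<N. b n + (if s \<le> n then x ^ s * a (n - s) else 0))"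
      by (intro sum.cong refl rec)
    also have "\<dots> = (\<Sum>n<N. b n) + x ^ s * (\<Sum>n<N - s. a n)"
      by (simp only: sum.distrib shift)
    also have "\<dots> \<le> B + x ^ s * (\<Sum>n<N. a n)"
    proof (intro add_mono mult_left_mono)
      show "(\<Sum>n<N. b n) \<le> B"
        using bs b0 by (metis sum_le_suminf sums_iff finite_lessThan)
      show "(\<Sum>n<N - s. a n) \<le> (\<Sum>n<N. a n)"
        using a0 by (intro sum_mono2) auto
    qed (use x in auto)
    finally have "(\<Sum>n<N. a n) * (1 - x ^ s) \<le> B" by (simp add: algebra_simps)
    thus ?thesis using xs by (simp add: pos_le_divide_eq)
  qed
  have "summable a"
    using a0 bound by (rule summableI_nonneg_bounded)
  hence as: "a sums suminf a" by (rule summable_sums)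
  have "(\<lambda>N. (\<Sum>n<N. b n) + x ^ s * (\<Sum>n<N - s. a n)) \<longlonglongrightarrow> B + x ^ s * suminf a"
  proof (intro tendsto_intros)
    show "(\<lambda>N. \<Sum>n<N. b n) \<longlonglongrightarrow> B" using bs by (simp add: sums_def)
    have "(\<lambda>N. \<Sum>n<N + s - s. a n) \<longlonglongrightarrow> suminf a" using as by (simp add: sums_def)
    thus "(\<lambda>N. \<Sum>n<N - s. a n) \<longlonglongrightarrow> suminf a" by (rule LIMSEQ_offset)
  qed
  moreover have "(\<Sum>n<N. b n) + x ^ s * (\<Sum>n<N - s. a n) = (\<Sum>n<N. a n)" for N
  proof -
    have "(\<Sum>n<N. a n) = (\<Sum>n<N. b n + (if s \<le> n then x ^ s * a (n - s) else 0))"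
      by (intro sum.cong refl rec)
    thus ?thesis by (simp only: sum.distrib shift)
  qed
  ultimately have "(\<lambda>N. \<Sum>n<N. a n) \<longlonglongrightarrow> B + x ^ s * suminf a" by simp
  hence "suminf a = B + x ^ s * suminf a"
    using as LIMSEQ_unique unfolding sums_def by blast
  hence "suminf a = B / (1 - x ^ s)"
    using xs by (simp add: field_simps)
  with as show ?case
    using insert by (simp add: a_def B_def)
qed

text \<open>No part of a partition of \<open>n\<close> exceeds \<open>n\<close>.\<close>

lemma num_partitions_restrict:
  assumes "n \<le> N"
  shows "num_partitions (S \<inter> {..N}) n = num_partitions S n"
proof -
  have "{P :: nat multiset. set_mset P \<subseteq> S \<inter> {..N} \<and> sum_mset P = n}
      = {P. set_mset P \<subseteq> S \<and> sum_mset P = n}"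
    using assms by (auto dest!: multi_member_split)
  thus ?thesis by (simp add: num_partitions_def)
qed

lemma num_partitions_mono:
  assumes "T \<subseteq> S" "0 \<notin> S"
  shows "num_partitions T n \<le> num_partitions S n"
  unfolding num_partitions_def using assms by (intro card_mono finite_partitions) auto

text \<open>The sum is squeezed: truncating the part set at \<open>g m\<close> leaves the first
  coefficients unchanged and never increases any, so the finite products \<open>f m\<close> both
  dominate partial sums and stay below the full sum.\<close>

lemma partition_sums:
  fixes x :: real
  assumes x: "0 < x" "x < 1" and S: "0 \<notin> S" and g: "\<And>m. m \<le> g m"
    and lim: "(\<lambda>m. \<Prod>s\<in>S \<inter> {..g m}. 1 - x ^ s) \<longlonglongrightarrow> L" and L: "L \<noteq> 0"
  shows "(\<lambda>n. real (num_partitions S n) * x ^ n) sums (1 / L)"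
proof -
  define a where "a = (\<lambda>n. real (num_partitions S n) * x ^ n)"
  define f where "f = (\<lambda>m. \<Prod>s\<in>S \<inter> {..g m}. 1 / (1 - x ^ s))"
  have a0: "a n \<ge> 0" for n using x by (simp add: a_def)
  have "f = (\<lambda>m. 1 / (\<Prod>s\<in>S \<inter> {..g m}. 1 - x ^ s))"
    by (auto simp: f_def prod_dividef)
  hence fl: "f \<longlonglongrightarrow> 1 / L"
    using lim L by (auto intro!: tendsto_intros)
  have fs: "(\<lambda>n. real (num_partitions (S \<inter> {..g m}) n) * x ^ n) sums f m" for m
    unfolding f_def using x S by (intro finite_partition_sums) auto
  have le: "(\<Sum>n<k. a n) \<le> f m" if "k \<le> m" for k m
  proof -
    have "(\<Sum>n<k. a n) = (\<Sum>n<k. real (num_partitions (S \<inter> {..g m}) n) * x ^ n)"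
    proof (rule sum.cong[OF refl])
      fix n assume "n \<in> {..<k}"
      hence "n \<le> g m" using that g[of m] by auto
      thus "a n = real (num_partitions (S \<inter> {..g m}) n) * x ^ n"
        by (simp add: a_def num_partitions_restrict)
    qed
    also have "\<dots> \<le> f m"
      using fs[of m] x by (subst sums_unique[OF fs]) (intro sum_le_suminf, auto simp: sums_iff)
    finally show ?thesis .
  qed
  have bound: "(\<Sum>n<k. a n) \<le> 1 / L" for k
    using fl le by (intro tendsto_lowerbound[OF fl]) (auto simp: eventually_at_top_linorder)
  hence sa: "summable a" using a0 by (intro summableI_nonneg_bounded)
  have "suminf a \<le> 1 / L" using sa bound by (intro suminf_le_const) auto
  moreover have "f m \<le> suminf a" for m
  proof -
    have "f m = (\<Sum>n. real (num_partitions (S \<inter> {..g m}) n) * x ^ n)"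
      by (rule sums_unique[OF fs])
    also have "\<dots> \<le> suminf a"
    proof (rule suminf_le)
      show "real (num_partitions (S \<inter> {..g m}) n) * x ^ n \<le> a n" for n
        unfolding a_def using x S by (intro mult_right_mono of_nat_mono num_partitions_mono) auto
    qed (use sa fs in \<open>auto simp: sums_iff\<close>)
    finally show ?thesis .
  qed
  hence "1 / L \<le> suminf a"
    by (intro tendsto_upperbound[OF fl]) auto
  ultimately have "suminf a = 1 / L" by simp
  thus ?thesis using summable_sums[OF sa] by (simp add: a_def)
qed

text \<open>Residues strictly between 0 and 30 exclude the class of 0, so positivity of
  \<open>n\<close> is automatic.\<close>

lemma pm_residues_iff:
  assumes R: "R \<subseteq> {0<..<30}"
  shows "n \<in> pm_residues (int ` R) 60 \<longleftrightarrow> n mod 60 \<in> R \<union> (\<lambda>a. 60 - a) ` R"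
proof -
  have n: "int n mod 60 = int (n mod 60)"
    by (simp add: zmod_int)
  have 1: "[int n = int r] (mod 60) \<longleftrightarrow> n mod 60 = r" if "r \<in> R" for r
  proof -
    have "r < 60" using that R by auto
    hence "int r mod 60 = int r" by simp
    thus ?thesis unfolding Cong.cong_def n by simp
  qed
  have 2: "[int n = - int r] (mod 60) \<longleftrightarrow> n mod 60 = 60 - r" if "r \<in> R" for r
  proof -
    have r: "0 < r" "r < 60" using that R by auto
    have "(- int r) mod 60 = (- int r + 60) mod 60" by (rule mod_add_self2[symmetric])
    also have "\<dots> = int (60 - r)" using r by (subst mod_pos_pos_trivial) auto
    finally show ?thesis unfolding Cong.cong_def n by (simp only: of_nat_eq_iff)
  qed
  have pos: "n > 0" if "r \<in> R" "n mod 60 = r \<or> n mod 60 = 60 - r" for r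
    using that R by (cases "n = 0") auto
  have "n \<in> pm_residues (int ` R) 60 \<longleftrightarrow>
      n > 0 \<and> (\<exists>r\<in>R. [int n = int r] (mod 60) \<or> [int n = - int r] (mod 60))"
    by (simp add: pm_residues_def)
  also have "(\<exists>r\<in>R. [int n = int r] (mod 60) \<or> [int n = - int r] (mod 60))
      \<longleftrightarrow> (\<exists>r\<in>R. n mod 60 = r \<or> n mod 60 = 60 - r)"
    by (rule bex_cong[OF refl]) (simp only: 1 2)
  also have "n > 0 \<and> \<dots> \<longleftrightarrow> (\<exists>r\<in>R. n mod 60 = r \<or> n mod 60 = 60 - r)"
    using pos by metis
  also have "\<dots> \<longleftrightarrow> n mod 60 \<in> R \<union> (\<lambda>a. 60 - a) ` R"
    by (simp only: Un_iff image_iff) metis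
  finally show ?thesis .
qed

lemma (in nome) residue_partition_sums:
  assumes R: "R \<subseteq> {0<..<30}"
  shows "(\<lambda>n. real (num_partitions (pm_residues (int ` R) 60) n) * q ^ n) sums (1 / (\<Prod>a\<in>R. br a))"
proof (rule partition_sums[where g = "\<lambda>m. 60 * m"])
  define A where "A = R \<union> (\<lambda>a. 60 - a) ` R"
  have finR: "finite R" using R finite_subset by blast
  have A: "finite A" "A \<subseteq> {0<..<60}" using R finR by (auto simp: A_def subset_iff)
  \<comment> \<open>Truncation at \<open>60 * m\<close> keeps exactly the first \<open>m\<close>
    members of every class, because no class is 0. Hence the finite products factor over the
    classes.\<close>
  have img: "pm_residues (int ` R) 60 \<inter> {..60 * m} = (\<lambda>(a, k). 60 * k + a) ` (A \<times> {..<m})" for m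
  proof (intro equalityI subsetI)
    fix n assume n: "n \<in> pm_residues (int ` R) 60 \<inter> {..60 * m}"
    hence a: "n mod 60 \<in> A" using pm_residues_iff[OF R] by (simp add: A_def)
    hence "n mod 60 > 0" using A by auto
    moreover have "60 * (n div 60) + n mod 60 = n" "n \<le> 60 * m" using n by simp_all
    ultimately have "n div 60 < m" by linarith
    hence "(n mod 60, n div 60) \<in> A \<times> {..<m}" using a by auto
    moreover have "n = (\<lambda>(a, k). 60 * k + a) (n mod 60, n div 60)" by simp
    ultimately show "n \<in> (\<lambda>(a, k). 60 * k + a) ` (A \<times> {..<m})" by blast
  next
    fix n assume "n \<in> (\<lambda>(a, k). 60 * k + a) ` (A \<times> {..<m})"
    then obtain a k where n: "n = 60 * k + a" "a \<in> A" "k < m" by auto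
    hence "a < 60" using A by auto
    hence "n mod 60 = a" "n \<le> 60 * m" using n by auto
    thus "n \<in> pm_residues (int ` R) 60 \<inter> {..60 * m}"
      using n pm_residues_iff[OF R] by (simp add: A_def)
  qed
  have inj: "inj_on (\<lambda>(a, k). 60 * k + a) (A \<times> {..<m})" for m
  proof (rule inj_onI, clarify)
    fix a k b l assume h: "a \<in> A" "b \<in> A" "60 * k + a = 60 * l + b"
    hence "a < 60" "b < 60" using A by auto
    hence "(60 * k + a) mod 60 = a" "(60 * k + a) div 60 = k" "(60 * l + b) mod 60 = b" "(60 * l + b) div 60 = l"
      by simp_all
    with h(3) show "a = b \<and> k = l" by metis
  qed
  have "(\<Prod>s\<in>pm_residues (int ` R) 60 \<inter> {..60 * m}. 1 - q ^ s) = (\<Prod>a\<in>A. \<Prod>k<m. 1 - q ^ (60 * k + a))" for m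
    unfolding img by (subst prod.reindex[OF inj]) (simp add: prod.cartesian_product case_prod_unfold)
  moreover have "(\<lambda>m. \<Prod>a\<in>A. \<Prod>k<m. 1 - q ^ (60 * k + a)) \<longlonglongrightarrow> (\<Prod>a\<in>A. prog 60 a)"
    using A by (intro tendsto_prod prog_tendsto) auto
  moreover have "(\<Prod>a\<in>A. prog 60 a) = (\<Prod>a\<in>R. br a)"
  proof -
    \<comment> \<open>Strictness of the bound 30 matters: a class equal to its own negative would be
      counted twice by \<open>br\<close>.\<close>
    have "R \<inter> (\<lambda>a. 60 - a) ` R = {}"
    proof (rule equals0I)
      fix a assume "a \<in> R \<inter> (\<lambda>a. 60 - a) ` R"
      then obtain b where "a \<in> R" "b \<in> R" "a = 60 - b" by auto
      moreover from this have "a < 30" "b < 30" using R by auto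
      ultimately show False by simp
    qed
    hence "(\<Prod>a\<in>A. prog 60 a) = (\<Prod>a\<in>R. prog 60 a) * (\<Prod>a\<in>(\<lambda>a. 60 - a) ` R. prog 60 a)"
      unfolding A_def using finR by (intro prod.union_disjoint) auto
    also have "(\<Prod>a\<in>(\<lambda>a. 60 - a) ` R. prog 60 a) = (\<Prod>a\<in>R. prog 60 (60 - a))"
      using R by (subst prod.reindex) (auto simp: inj_on_def subset_iff)
    finally show ?thesis by (simp add: br_def prod.distrib)
  qed
  ultimately show "(\<lambda>m. \<Prod>s\<in>pm_residues (int ` R) 60 \<inter> {..60 * m}. 1 - q ^ s) \<longlonglongrightarrow> (\<Prod>a\<in>R. br a)"
    by simp
  show "(\<Prod>a\<in>R. br a) \<noteq> 0"
    using R finR br_nonzero by (auto simp: subset_iff)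
qed (use q_pos q_less_1 zero_notin_pm_residues in auto)

text \<open>Agreement is known only for positive arguments below 1, but these accumulate at 0, where
  the zeros of a nonzero power series are isolated.\<close>

lemma powser_unique:
  fixes a b :: "nat \<Rightarrow> real"
  assumes "\<And>x. 0 < x \<Longrightarrow> x < 1 \<Longrightarrow> \<exists>s. (\<lambda>n. a n * x ^ n) sums s \<and> (\<lambda>n. b n * x ^ n) sums s"
  shows "a = b"
proof (rule ccontr)
  assume "a \<noteq> b"
  then obtain m where m: "a m \<noteq> b m" by auto
  \<comment> \<open>Shifting the difference by one place forces the value 0 at the origin, as the
    statement on isolated zeros requires, and keeps the nonzero coefficient at a positive
    index.\<close>
  define c where "c = (\<lambda>n. case n of 0 \<Rightarrow> 0 | Suc k \<Rightarrow> a k - b k)"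
  have c0: "(\<lambda>n. (a n - b n) * x ^ n) sums 0" if x: "0 < x" "x < 1" for x
    using assms[OF x] sums_diff by (fastforce simp: algebra_simps)
  have cs: "(\<lambda>n. c n * x ^ n) sums 0" if x: "0 < x" "x < 1" for x
  proof -
    have "(\<lambda>n. c (Suc n) * x ^ Suc n) sums (x * 0)"
      using sums_mult[OF c0[OF x], of x] by (simp add: c_def mult_ac)
    thus ?thesis by (subst (asm) sums_Suc_iff) (simp add: c_def)
  qed
  define f where "f = (\<lambda>x. \<Sum>n. c n * x ^ n)"
  have sm: "(\<lambda>n. c n * (x - 0) ^ n) sums f x" if "norm (x - 0) < 1" for x
  proof -
    define y where "y = (1 + norm x) / 2"
    have y: "norm x < y" "y < 1" using that by (auto simp: y_def)
    hence "summable (\<lambda>n. c n * y ^ n)"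
      using cs[of y] norm_ge_zero[of x] by (auto simp: sums_iff)
    hence "summable (\<lambda>n. c n * x ^ n)"
      by (rule powser_inside) (use y in auto)
    thus ?thesis by (simp add: f_def summable_sums)
  qed
  have f0: "f 0 = 0" by (simp add: f_def c_def)
  have cm: "c (Suc m) \<noteq> 0" using m by (simp add: c_def)
  obtain s where s: "0 < s" "\<And>z. z \<in> cball 0 s - {0} \<Longrightarrow> f z \<noteq> 0"
    using powser_0_nonzero[of 1 0 c f "Suc m", OF _ sm f0 cm] by auto
  define z where "z = min s (1/2)"
  have "0 < z" "z < 1" "z \<le> s" using s by (auto simp: z_def)
  hence "f z \<noteq> 0" "f z = 0"
    using s(2)[of z] cs[of z] by (auto simp: f_def sums_iff)
  thus False by simp
qed

section \<open>The four identities\<close>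

context nome
begin


lemma identity_1:
  "q * (br 8 * br 14 * (br 11 * br 19)) = br 6 * br 9 * br 21 * br 28 * (1 - core_prod * (br 8 * br 14))"
proof -
  have c: "(br 6 * br 18 * br 30) * br 28 - q * br 8 * br 14 * (br 20 * br 28 + q ^ 9 * (br 2 * br 10))
      = core_prod * (br 6 * br 18 * br 30) * br 8 * br 14 * br 28"
    by (rule elimination_1[OF level_12_relation br_rel_14 br_rel_26]) (simp add: br_nonzero)
  \<comment> \<open>The extra factors complete \<open>br 6\<close> to
    \<open>br 6 * br 18 * br 30\<close> and \<open>br 11 * br 19\<close> to the left side of
    \<open>br_rel_11\<close>; they are cancelled at the end. The other identities are treated in the
    same way.\<close>
  have "br 18 * br 30 * (q * (br 8 * br 14 * (br 11 * br 19)))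
      = q * (br 8 * br 14) * (br 11 * br 19 * br 18 * br 30)"
    by (simp only: mult_ac)
  also have "\<dots> = br 9 * br 21 * (q * br 8 * br 14 * (br 20 * br 28 + q ^ 9 * (br 2 * br 10)))"
    unfolding br_rel_11 by (simp only: distrib_left mult_ac)
  also have "q * br 8 * br 14 * (br 20 * br 28 + q ^ 9 * (br 2 * br 10))
      = (br 6 * br 18 * br 30) * br 28 - core_prod * (br 6 * br 18 * br 30) * br 8 * br 14 * br 28"
    using c by (simp only: eq_diff_eq diff_eq_eq add.commute)
  also have "br 9 * br 21 * \<dots> = br 18 * br 30 * (br 6 * br 9 * br 21 * br 28 * (1 - core_prod * (br 8 * br 14)))"
    by (simp only: right_diff_distrib mult_ac mult_1_right mult_1_left)
  finally show ?thesis using br_nonzero[of 18] br_nonzero[of 30] by simp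
qed

lemma identity_7:
  "q * (br 4 * br 22 * (br 13 * br 17)) = br 3 * br 16 * br 18 * br 27 * (1 - core_prod * (br 4 * br 22))"
proof -
  have c: "(br 6 * br 18 * br 30) * br 16 - q * br 4 * br 22 * (br 16 * br 20 + q ^ 3 * (br 10 * br 14))
      = core_prod * (br 6 * br 18 * br 30) * br 4 * br 22 * br 16"
    by (rule elimination_7[OF level_12_relation br_rel_22 br_rel_2]) (simp add: br_nonzero)
  have "br 6 * br 30 * (q * (br 4 * br 22 * (br 13 * br 17)))
      = q * (br 4 * br 22) * (br 13 * br 17 * br 6 * br 30)"
    by (simp only: mult_ac)
  also have "\<dots> = br 3 * br 27 * (q * br 4 * br 22 * (br 16 * br 20 + q ^ 3 * (br 10 * br 14)))"
    unfolding br_rel_13 by (simp only: distrib_left mult_ac)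
  also have "q * br 4 * br 22 * (br 16 * br 20 + q ^ 3 * (br 10 * br 14))
      = (br 6 * br 18 * br 30) * br 16 - core_prod * (br 6 * br 18 * br 30) * br 4 * br 22 * br 16"
    using c by (simp only: eq_diff_eq diff_eq_eq add.commute)
  also have "br 3 * br 27 * \<dots> = br 6 * br 30 * (br 3 * br 16 * br 18 * br 27 * (1 - core_prod * (br 4 * br 22)))"
    by (simp only: right_diff_distrib mult_ac mult_1_right mult_1_left)
  finally show ?thesis using br_nonzero[of 6] br_nonzero[of 30] by simp
qed

text \<open>Under the multiplier 11 the power of \<open>q\<close> moves to the other quotient and
  the relative sign changes, so the term with two odd brackets is now the larger one.\<close>

lemma identity_11:
  "br 1 * br 29 * (br 26 * br 28) = br 6 * br 8 * br 9 * br 21 * (q ^ 6 + core_prod * (br 26 * br 28))"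
proof -
  have c: "(br 10 * br 22 - q * (br 8 * br 20)) * br 26 * br 28 - q ^ 6 * (br 6 * br 18 * br 30) * br 8
      = core_prod * (br 6 * br 18 * br 30) * br 8 * br 26 * br 28"
    by (rule elimination_11[OF level_12_relation br_rel_14 br_rel_26]) (simp add: br_nonzero)
  have "br 18 * br 30 * (br 1 * br 29 * (br 26 * br 28)) = br 26 * br 28 * (br 1 * br 29 * br 18 * br 30)"
    by (simp only: mult_ac)
  also have "\<dots> = br 9 * br 21 * ((br 10 * br 22 - q * (br 8 * br 20)) * br 26 * br 28)"
    unfolding br_rel_1 by (simp only: right_diff_distrib left_diff_distrib mult_ac)
  also have "(br 10 * br 22 - q * (br 8 * br 20)) * br 26 * br 28
      = q ^ 6 * (br 6 * br 18 * br 30) * br 8 + core_prod * (br 6 * br 18 * br 30) * br 8 * br 26 * br 28"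
    using c by (simp only: diff_eq_eq add.commute)
  also have "br 9 * br 21 * \<dots> = br 18 * br 30 * (br 6 * br 8 * br 9 * br 21 * (q ^ 6 + core_prod * (br 26 * br 28)))"
    by (simp only: distrib_left mult_ac)
  finally show ?thesis using br_nonzero[of 18] br_nonzero[of 30] by simp
qed

text \<open>Here the power of \<open>q\<close> is attached to \<open>core_prod\<close>; this
  \<open>q\<^sup>2\<close> is the source of the exceptional value \<open>n = 2\<close>.\<close>

lemma identity_17:
  "br 2 * br 16 * (br 7 * br 23) = br 3 * br 4 * br 18 * br 27 * (1 - q\<^sup>2 * (core_prod * (br 2 * br 16)))"
proof -
  have c: "(br 6 * br 18 * br 30) * br 4 - br 2 * br 16 * (br 10 * br 26 + q ^ 3 * (br 4 * br 20))
      = q\<^sup>2 * core_prod * (br 6 * br 18 * br 30) * br 2 * br 16 * br 4"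
    by (rule elimination_17[OF level_12_relation br_rel_22 br_rel_2]) (simp add: br_nonzero)
  have "br 6 * br 30 * (br 2 * br 16 * (br 7 * br 23)) = br 2 * br 16 * (br 7 * br 23 * br 6 * br 30)"
    by (simp only: mult_ac)
  also have "\<dots> = br 3 * br 27 * (br 2 * br 16 * (br 10 * br 26 + q ^ 3 * (br 4 * br 20)))"
    unfolding br_rel_7 by (simp only: distrib_left mult_ac)
  also have "br 2 * br 16 * (br 10 * br 26 + q ^ 3 * (br 4 * br 20))
      = (br 6 * br 18 * br 30) * br 4 - q\<^sup>2 * core_prod * (br 6 * br 18 * br 30) * br 2 * br 16 * br 4"
    using c by (simp only: eq_diff_eq diff_eq_eq add.commute)
  also have "br 3 * br 27 * \<dots> = br 6 * br 30 * (br 3 * br 4 * br 18 * br 27 * (1 - q\<^sup>2 * (core_prod * (br 2 * br 16))))"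
    by (simp only: right_diff_distrib mult_ac mult_1_right mult_1_left)
  finally show ?thesis using br_nonzero[of 6] br_nonzero[of 30] by simp
qed

lemma core_prod_nonzero: "core_prod \<noteq> 0"
  by (simp add: core_prod_def br_nonzero)

end

text \<open>In parts (i) and (ii) the product for \<open>S\<close> is \<open>E * a\<close> and that
  for \<open>T\<close> is \<open>E * b / c\<close>. Dividing the bracket identity by
  \<open>E * a * b\<close> yields the relation of generating functions.\<close>

lemma reciprocal_identity:
  fixes E a b c P T t :: real
  assumes "P = E * a" "T * c = E * b" "t * (a * c) = b * (1 - E * a)"
    and "E \<noteq> 0" "a \<noteq> 0" "b \<noteq> 0" "c \<noteq> 0"
  shows "1 / P = 1 + t * (1 / T)"
proof -
  have T: "T = E * b / c" using assms by (simp add: field_simps)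
  have "t * c = b * (1 - E * a) / a" using assms by (simp add: field_simps)
  hence "t * (1 / T) = (1 - E * a) / (E * a)"
    unfolding T using assms by (simp add: field_simps)
  thus ?thesis using assms by (simp add: field_simps)
qed

text \<open>Comparison of coefficients: the factor \<open>q ^ k\<close> shifts the index, and the
  summand 1 affects only index 0, which lies below \<open>k\<close>.\<close>

lemma shifted_partitions:
  fixes k :: nat
  assumes R: "R \<subseteq> {0<..<30}" "R' \<subseteq> {0<..<30}" and k: "k > 0"
    and id: "\<And>q. nome q \<Longrightarrow> 1 / (\<Prod>a\<in>R. nome.br q a) = 1 + q ^ k * (1 / (\<Prod>a\<in>R'. nome.br q a))"
    and n: "n \<ge> k"
  shows "num_partitions (pm_residues (int ` R) 60) n = num_partitions (pm_residues (int ` R') 60) (n - k)"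
proof -
  define a where "a = (\<lambda>n. real (num_partitions (pm_residues (int ` R) 60) n))"
  define b where "b = (\<lambda>n. real (num_partitions (pm_residues (int ` R') 60) n))"
  define c where "c = (\<lambda>n. if n < k then (if n = 0 then 1 else 0) else b (n - k))"
  have "a = c"
  proof (rule powser_unique)
    fix x :: real assume "0 < x" "x < 1"
    then interpret nome x by unfold_locales
    define B where "B = 1 / (\<Prod>a\<in>R'. br a)"
    have bs: "(\<lambda>n. b n * x ^ n) sums B"
      unfolding b_def B_def by (rule residue_partition_sums[OF R(2)])
    have "(\<lambda>n. c (n + k) * x ^ (n + k)) sums (x ^ k * B)"
      using sums_mult[OF bs, of "x ^ k"] by (simp add: c_def power_add mult_ac)
    hence "(\<lambda>n. c n * x ^ n) sums (x ^ k * B + (\<Sum>n<k. c n * x ^ n))"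
      by (rule iffD1[OF sums_iff_shift])
    also have "(\<Sum>n<k. c n * x ^ n) = (\<Sum>n\<in>{0::nat}. 1)"
      using k by (intro sum.mono_neutral_cong_right) (auto simp: c_def)
    finally have "(\<lambda>n. c n * x ^ n) sums (1 + x ^ k * B)" by (simp add: add.commute)
    moreover have "(\<lambda>n. a n * x ^ n) sums (1 + x ^ k * B)"
      using residue_partition_sums[OF R(1)] id[OF nome_axioms] by (simp add: a_def B_def)
    ultimately show "\<exists>s. (\<lambda>n. a n * x ^ n) sums s \<and> (\<lambda>n. c n * x ^ n) sums s" by blast
  qed
  hence "a n = b (n - k)" using n by (simp add: c_def)
  thus ?thesis by (simp add: a_def b_def)
qed

theorem theorem12p5:
  shows
    "(let S = pm_residues {1, 7, 8, 10, 11, 13, 14, 17, 19, 20, 23, 29} 60;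
          T = pm_residues {1, 6, 7, 9, 10, 13, 17, 20, 21, 23, 28, 29} 60
      in (\<forall>n\<ge>1. num_partitions S n = num_partitions T (n - 1))) \<and>
     (let S = pm_residues {1, 4, 7, 10, 11, 13, 17, 19, 20, 22, 23, 29} 60;
          T = pm_residues {1, 3, 7, 10, 11, 16, 18, 19, 20, 23, 27, 29} 60
      in (\<forall>n\<ge>1. num_partitions S n = num_partitions T (n - 1))) \<and>
     (let S = pm_residues {6, 7, 8, 9, 10, 11, 13, 17, 19, 20, 21, 23} 60;
          T = pm_residues {1, 7, 10, 11, 13, 17, 19, 20, 23, 26, 28, 29} 60
      in (\<forall>n\<ge>6. num_partitions S n = num_partitions T (n - 6))) \<and>
     (let S = pm_residues {1, 3, 4, 10, 11, 13, 17, 18, 19, 20, 27, 29} 60;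
          T = pm_residues {1, 2, 7, 10, 11, 13, 16, 17, 19, 20, 23, 29} 60
      in (\<forall>n. n \<noteq> 2 \<longrightarrow> num_partitions S n = num_partitions T n))"
proof -
  have p1: "num_partitions (pm_residues {1, 7, 8, 10, 11, 13, 14, 17, 19, 20, 23, 29} 60) n
      = num_partitions (pm_residues {1, 6, 7, 9, 10, 13, 17, 20, 21, 23, 28, 29} 60) (n - 1)" if "n \<ge> 1" for n
  proof -
    define R where "R = {1, 7, 8, 10, 11, 13, 14, 17, 19, 20, 23, 29::nat}"
    define R' where "R' = {1, 6, 7, 9, 10, 13, 17, 20, 21, 23, 28, 29::nat}"
    have "num_partitions (pm_residues (int ` R) 60) n = num_partitions (pm_residues (int ` R') 60) (n - 1)"
    proof (rule shifted_partitions[OF _ _ _ _ that])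
      fix q :: real assume "nome q"
      then interpret nome q .
      show "1 / (\<Prod>a\<in>R. br a) = 1 + q ^ 1 * (1 / (\<Prod>a\<in>R'. br a))"
        by (rule reciprocal_identity[OF _ _ _ core_prod_nonzero,
              where a = "br 8 * br 14" and b = "br 6 * br 9 * br 21 * br 28" and c = "br 11 * br 19"])
          (use identity_1 in \<open>simp_all add: R_def R'_def core_prod_def br_nonzero mult_ac\<close>)
    qed (auto simp: R_def R'_def)
    thus ?thesis by (simp add: R_def R'_def)
  qed
  have p2: "num_partitions (pm_residues {1, 4, 7, 10, 11, 13, 17, 19, 20, 22, 23, 29} 60) n
      = num_partitions (pm_residues {1, 3, 7, 10, 11, 16, 18, 19, 20, 23, 27, 29} 60) (n - 1)" if "n \<ge> 1" for n
  proof -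
    define R where "R = {1, 4, 7, 10, 11, 13, 17, 19, 20, 22, 23, 29::nat}"
    define R' where "R' = {1, 3, 7, 10, 11, 16, 18, 19, 20, 23, 27, 29::nat}"
    have "num_partitions (pm_residues (int ` R) 60) n = num_partitions (pm_residues (int ` R') 60) (n - 1)"
    proof (rule shifted_partitions[OF _ _ _ _ that])
      fix q :: real assume "nome q"
      then interpret nome q .
      show "1 / (\<Prod>a\<in>R. br a) = 1 + q ^ 1 * (1 / (\<Prod>a\<in>R'. br a))"
        by (rule reciprocal_identity[OF _ _ _ core_prod_nonzero,
              where a = "br 4 * br 22" and b = "br 3 * br 16 * br 18 * br 27" and c = "br 13 * br 17"])
          (use identity_7 in \<open>simp_all add: R_def R'_def core_prod_def br_nonzero mult_ac\<close>)
    qed (auto simp: R_def R'_def)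
    thus ?thesis by (simp add: R_def R'_def)
  qed
  have p3: "num_partitions (pm_residues {6, 7, 8, 9, 10, 11, 13, 17, 19, 20, 21, 23} 60) n
      = num_partitions (pm_residues {1, 7, 10, 11, 13, 17, 19, 20, 23, 26, 28, 29} 60) (n - 6)" if "n \<ge> 6" for n
  proof -
    define R where "R = {6, 7, 8, 9, 10, 11, 13, 17, 19, 20, 21, 23::nat}"
    define R' where "R' = {1, 7, 10, 11, 13, 17, 19, 20, 23, 26, 28, 29::nat}"
    have "num_partitions (pm_residues (int ` R) 60) n = num_partitions (pm_residues (int ` R') 60) (n - 6)"
    proof (rule shifted_partitions[OF _ _ _ _ that])
      fix q :: real assume "nome q"
      then interpret nome q .
      \<comment> \<open>The roles are reversed here: the product for \<open>T\<close> is a multiple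
        of \<open>core_prod\<close>, while that for \<open>S\<close> has the denominator
        \<open>br 1 * br 29\<close>. Dividing \<open>T = P * (q ^ 6 + T)\<close> by
        \<open>P * T\<close> gives the claim.\<close>
      define P T where "P = (\<Prod>a\<in>R. br a)" and "T = (\<Prod>a\<in>R'. br a)"
      have P: "P * (br 1 * br 29) = core_prod * (br 6 * br 8 * br 9 * br 21)"
        by (simp add: P_def R_def core_prod_def)
      have T: "T = core_prod * (br 26 * br 28)"
        by (simp add: T_def R'_def core_prod_def)
      have nz: "P \<noteq> 0" "T \<noteq> 0" "br 1 \<noteq> 0" "br 29 \<noteq> 0"
        by (simp_all add: P_def T_def R_def R'_def br_nonzero)
      have "core_prod * (br 1 * br 29 * (br 26 * br 28)) = core_prod * (br 6 * br 8 * br 9 * br 21) * (q ^ 6 + T)"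
        unfolding identity_11 T by (simp only: mult_ac)
      hence "T * (br 1 * br 29) = P * (q ^ 6 + T) * (br 1 * br 29)"
        unfolding T P[symmetric] by (simp only: mult_ac)
      hence "T = P * (q ^ 6 + T)" using nz by simp
      thus "1 / (\<Prod>a\<in>R. br a) = 1 + q ^ 6 * (1 / (\<Prod>a\<in>R'. br a))"
        unfolding P_def[symmetric] T_def[symmetric] using nz by (simp add: field_simps)
    qed (auto simp: R_def R'_def)
    thus ?thesis by (simp add: R_def R'_def)
  qed
  have p4: "num_partitions (pm_residues {1, 3, 4, 10, 11, 13, 17, 18, 19, 20, 27, 29} 60) n
      = num_partitions (pm_residues {1, 2, 7, 10, 11, 13, 16, 17, 19, 20, 23, 29} 60) n" if "n \<noteq> 2" for n
  proof -
    define R where "R = {1, 3, 4, 10, 11, 13, 17, 18, 19, 20, 27, 29::nat}"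
    define R' where "R' = {1, 2, 7, 10, 11, 13, 16, 17, 19, 20, 23, 29::nat}"
    define a where "a = (\<lambda>n. real (num_partitions (pm_residues (int ` R) 60) n))"
    define b where "b = (\<lambda>n. real (num_partitions (pm_residues (int ` R') 60) n))"
    \<comment> \<open>The generating functions differ by exactly \<open>q\<^sup>2\<close>, so at
      \<open>n = 2\<close> the count for \<open>T\<close> is larger by one and all other counts
      agree.\<close>
    have "(\<lambda>n. a n + (if n = 2 then 1 else 0)) = b"
    proof (rule powser_unique)
      fix q :: real assume "0 < q" "q < 1"
      then interpret nome q by unfold_locales
      define P T where "P = (\<Prod>a\<in>R. br a)" and "T = (\<Prod>a\<in>R'. br a)"
      have P: "P * (br 7 * br 23) = core_prod * (br 3 * br 4 * br 18 * br 27)"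
        by (simp add: P_def R_def core_prod_def)
      have T: "T = core_prod * (br 2 * br 16)"
        by (simp add: T_def R'_def core_prod_def)
      have nz: "P \<noteq> 0" "T \<noteq> 0" "br 7 \<noteq> 0" "br 23 \<noteq> 0"
        by (simp_all add: P_def T_def R_def R'_def br_nonzero)
      have "core_prod * (br 2 * br 16 * (br 7 * br 23)) = core_prod * (br 3 * br 4 * br 18 * br 27) * (1 - q\<^sup>2 * T)"
        unfolding identity_17 T by (simp only: mult_ac)
      hence "T * (br 7 * br 23) = P * (1 - q\<^sup>2 * T) * (br 7 * br 23)"
        unfolding T P[symmetric] by (simp only: mult_ac)
      hence "T = P * (1 - q\<^sup>2 * T)" using nz by simp
      hence PT: "1 / P + q\<^sup>2 = 1 / T" using nz by (simp add: field_simps)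
      have RR: "R \<subseteq> {0<..<30}" "R' \<subseteq> {0<..<30}" by (auto simp: R_def R'_def)
      have "(\<lambda>n. (if n = 2 then 1 else 0) * q ^ n) sums q\<^sup>2"
        using sums_If_finite[of "\<lambda>n. n = 2" "\<lambda>n. q ^ n"] by (simp add: if_distrib[of "\<lambda>x. x * _"] cong: if_cong)
      from sums_add[OF residue_partition_sums[OF RR(1)] this]
      have "(\<lambda>n. (a n + (if n = 2 then 1 else 0)) * q ^ n) sums (1 / T)"
        using PT by (simp add: a_def P_def algebra_simps)
      moreover have "(\<lambda>n. b n * q ^ n) sums (1 / T)"
        unfolding b_def T_def by (rule residue_partition_sums[OF RR(2)])
      ultimately show "\<exists>s. (\<lambda>n. (a n + (if n = 2 then 1 else 0)) * q ^ n) sums s \<and> (\<lambda>n. b n * q ^ n) sums s"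
        by blast
    qed
    hence "a n = b n" using that by (auto dest: fun_cong[of _ _ n])
    thus ?thesis by (simp add: a_def b_def R_def R'_def)
  qed
  show ?thesis
    unfolding Let_def using p1 p2 p3 p4 by blast
qed

end
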